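(* Let $V$ be an L-embedded Banach space and let $A\subseteq V$ be a non-empty bounded subset. Then there is a point $v_0\in V$ that is fixed by every isometry of $V$ preserving $A$ (a single point $v_0$ fixed by all such isometries simultaneously). Moreover, $v_0$ can be chosen so that it minimises $\sup_{a\in A}\|v-a\|$ over all $v\in V$, i.e. $\sup_{a\in A}\|v_0-a\| = \min_{v\in V}\sup_{a\in A}\|v-a\|$.
   Context: A Banach space $V$ is called L-embedded if, viewing $V$ as a subspace of its bidual $V^{**}$ via the canonical embedding, there is a subspace $V_0\subseteq V^{**}$ such that $V^{**}=V\oplus_1 V_0$, meaning that $V^{**}$ is the direct sum of $V$ and $V_0$ and $\|v+w\|=\|v\|+\|w\|$ for all $v\in V$, $w\in V_0$. An isometry of $V$ is a bijective distance-preserving map $T:V\to V$ (not assumed to be linear or to fix $0$); it preserves $A$ if $T(A)=A$. *)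

theory Defs
  imports "HOL-Analysis.Analysis"
begin

text \<open>
  For a real normed space \<open>'a\<close>, the dual is the type \<open>'a \<Rightarrow>\<^sub>L real\<close> of bounded linear functionals
  with the operator norm, and the bidual is \<open>('a \<Rightarrow>\<^sub>L real) \<Rightarrow>\<^sub>L real\<close>.
\<close>

lift_definition bidual_embedding ::
    "'a::real_normed_vector \<Rightarrow> (('a \<Rightarrow>\<^sub>L real) \<Rightarrow>\<^sub>L real)"
  is "\<lambda>v f. blinfun_apply f v"
  by (rule blinfun.bounded_linear_left)

definition l1_direct_sum :: "'b::real_normed_vector set \<Rightarrow> 'b set \<Rightarrow> bool" where
  "l1_direct_sum U W \<longleftrightarrow>
     subspace U \<and> subspace W \<and> U \<inter> W = {0} \<and>
     (\<forall>z. \<exists>u\<in>U. \<exists>w\<in>W. z = u + w) \<and>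
     (\<forall>u\<in>U. \<forall>w\<in>W. norm (u + w) = norm u + norm w)"

text \<open>The summand \<open>V\<^sub>0\<close> is a linear subspace; its closedness follows from the norm identity.\<close>

definition L_embedded :: "'a::real_normed_vector itself \<Rightarrow> bool" where
  "L_embedded _ \<longleftrightarrow>
     (\<exists>V\<^sub>0 :: (('a \<Rightarrow>\<^sub>L real) \<Rightarrow>\<^sub>L real) set.
        l1_direct_sum (range (bidual_embedding :: 'a \<Rightarrow> _)) V\<^sub>0)"

text \<open>Neither linearity nor \<open>T 0 = 0\<close> is required.\<close>

definition space_isometry :: "('a::metric_space \<Rightarrow> 'a) \<Rightarrow> bool" where
  "space_isometry T \<longleftrightarrow> bij T \<and> (\<forall>x y. dist (T x) (T y) = dist x y)"

end

theory Submission
  imports Defs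
begin

text \<open>
  Let \<open>r\<close> be the infimum over \<open>v\<close> of the radius \<open>sup\<^bsub>a\<in>A\<^esub> \<parallel>v - a\<parallel>\<close>, and let \<open>C\<close> be the set of
  Chebyshev centres of \<open>A\<close>, the intersection of the balls of radius \<open>r\<close> about the points of \<open>A\<close>.
  The same intersection formed in the bidual is weak-* compact, and it is non-empty because it is
  the intersection of the analogous sets for the radii \<open>s > r\<close>, each of which contains points of
  \<open>V\<close>. If \<open>v + w\<close> with \<open>v \<in> V\<close>, \<open>w \<in> V\<^sub>0\<close> lies in it, then
  \<open>\<parallel>v - a\<parallel> + \<parallel>w\<parallel> = \<parallel>v + w - a\<parallel> \<le> r\<close> for all \<open>a\<close>, so \<open>v\<close> has radius at most \<open>r - \<parallel>w\<parallel>\<close>, and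
  \<open>w = 0\<close> by the choice of \<open>r\<close>. Thus the bidual centres all lie in \<open>V\<close>, and \<open>C\<close> is a non-empty,
  convex, weakly compact subset of \<open>V\<close> (lemma \<open>L_embedded_Chebyshev_center\<close>). Every isometry that
  preserves \<open>A\<close> preserves \<open>C\<close>.

  What remains is the case of isometries of the fixed point theorem of Ryll-Nardzewski (theorem
  \<open>common_fixed_point_weakly_compact\<close>): isometries of \<open>V\<close> that preserve a non-empty, convex, weakly
  compact set have a common fixed point in it. The isometries are affine by the Mazur-Ulam
  theorem, hence weakly continuous, and their fixed point sets are weakly closed; by compactness it
  is enough to treat finitely many isometries at a time. Let \<open>C\<^sub>0\<close> be minimal among the non-empty,
  invariant, convex, weakly closed subsets. The orbits in \<open>C\<^sub>0\<close> under the generated group are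
  countable, so the weak closure of an orbit is norm separable; take in it a minimal non-empty
  invariant weakly closed set \<open>M\<close>. Countably many small balls, which are weakly closed, cover
  \<open>M\<close>, so by Baire's theorem some non-empty relatively weakly open part of \<open>M\<close> is small in norm, and
  by minimality such parts cover \<open>M\<close>. Hence \<open>M\<close> is totally bounded
  (lemma \<open>minimal_invariant_totally_bounded\<close>).
  If \<open>M\<close> had diameter \<open>d > 0\<close>, averaging a finite \<open>d/2\<close>-net would give a point of \<open>C\<^sub>0\<close> at distance
  at most some \<open>\<rho> < d\<close> from all of \<open>M\<close> (lemma \<open>nondiametral_point\<close>, an argument of DeMarr). The
  points of \<open>C\<^sub>0\<close> with this property form an invariant, convex, weakly closed set, which is all of
  \<open>C\<^sub>0\<close> by minimality and so contains \<open>M\<close>, and \<open>M\<close> would have diameter at most \<open>\<rho>\<close>. So \<open>M\<close> is a single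
  point, which is fixed.
\<close>

section \<open>Sublinear functionals and the Hahn-Banach theorem\<close>

definition sublinear :: "('a::real_vector \<Rightarrow> real) \<Rightarrow> bool" where
  "sublinear p \<longleftrightarrow>
     (\<forall>x y. p (x + y) \<le> p x + p y) \<and> (\<forall>c\<ge>0. \<forall>x. p (c *\<^sub>R x) = c * p x)"

lemma sublinear_add: "sublinear p \<Longrightarrow> p (x + y) \<le> p x + p y"
  and sublinear_scale: "sublinear p \<Longrightarrow> 0 \<le> c \<Longrightarrow> p (c *\<^sub>R x) = c * p x"
  by (auto simp: sublinear_def)

lemma sublinear_zero: "sublinear p \<Longrightarrow> p 0 = 0"
  using sublinear_scale[of p 0 0] by simp

lemma sublinear_minus_ge: "sublinear p \<Longrightarrow> - p (- x) \<le> p x"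
  using sublinear_add[of p x "- x"] sublinear_zero[of p] by simp

lemma sublinearI:
  assumes add: "\<And>x y. p (x + y) \<le> p x + p y"
    and zero: "p 0 = 0"
    and scale: "\<And>c x. 0 < c \<Longrightarrow> p (c *\<^sub>R x) \<le> c * p x"
  shows "sublinear p"
  unfolding sublinear_def
proof (intro conjI allI impI add)
  fix c :: real and x
  assume "0 \<le> c"
  show "p (c *\<^sub>R x) = c * p x"
  proof (cases "c = 0")
    case True
    then show ?thesis by (simp add: zero)
  next
    case False
    with \<open>0 \<le> c\<close> have c: "0 < c" by simp
    have "p (inverse c *\<^sub>R (c *\<^sub>R x)) \<le> inverse c * p (c *\<^sub>R x)"
      using c by (intro scale) simp
    then have "c * p x \<le> p (c *\<^sub>R x)"
      using c by (simp add: field_simps)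
    with scale[OF c] show ?thesis by (meson antisym)
  qed
qed

text \<open>
  Pushing \<open>p\<close> down along \<open>v\<close>: the functional \<open>q x = inf\<^bsub>t \<ge> 0\<^esub> (p (x + t v) - t p v)\<close> is still
  sublinear and is the tool for both uses of the Hahn-Banach argument. Applied to a minimal \<open>p\<close> it
  shows that \<open>p\<close> is odd; applied once before minimising it pins the value at \<open>v\<close>.
\<close>

lemma sublinear_reduce:
  fixes p :: "'a::real_vector \<Rightarrow> real"
  assumes p: "sublinear p"
  obtains q where "sublinear q" "q \<le> p" "q (- v) \<le> - p v"
proof
  define S where "S x = (\<lambda>t. p (x + t *\<^sub>R v) - t * p v) ` {0..}" for x
  define q where "q x = Inf (S x)" for x
  have S_ne: "S x \<noteq> {}" for x
    by (auto simp: S_def)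
  have lower: "- p (- x) \<le> y" if y: "y \<in> S x" for x y
  proof -
    obtain t where t: "0 \<le> t" "y = p (x + t *\<^sub>R v) - t * p v"
      using y by (auto simp: S_def)
    have "t * p v = p (- x + (x + t *\<^sub>R v))"
      using sublinear_scale[OF p t(1), of v] by simp
    also have "\<dots> \<le> p (- x) + p (x + t *\<^sub>R v)"
      by (rule sublinear_add[OF p])
    finally show ?thesis using t by simp
  qed
  have q_le: "q x \<le> p (x + t *\<^sub>R v) - t * p v" if "0 \<le> t" for x t
    unfolding q_def
  proof (rule cInf_lower)
    show "bdd_below (S x)" using lower by (meson bdd_belowI)
  qed (use that in \<open>auto simp: S_def\<close>)
  have q_ge: "b \<le> q x" if "\<And>t. 0 \<le> t \<Longrightarrow> b \<le> p (x + t *\<^sub>R v) - t * p v" for b x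
    unfolding q_def by (rule cInf_greatest[OF S_ne]) (use that in \<open>auto simp: S_def\<close>)
  show "q \<le> p"
    using q_le[of 0] by (simp add: le_fun_def)
  show "q (- v) \<le> - p v"
    using q_le[of 1 "- v"] sublinear_zero[OF p] by simp
  show "sublinear q"
  proof (rule sublinearI)
    fix x y
    have "q (x + y) - (p (y + t *\<^sub>R v) - t * p v) \<le> q x" if "0 \<le> t" for t
    proof (rule q_ge)
      fix s :: real assume "0 \<le> s"
      have "q (x + y) \<le> p (x + y + (s + t) *\<^sub>R v) - (s + t) * p v"
        using \<open>0 \<le> s\<close> \<open>0 \<le> t\<close> by (intro q_le) simp
      also have "x + y + (s + t) *\<^sub>R v = (x + s *\<^sub>R v) + (y + t *\<^sub>R v)"
        by (simp add: algebra_simps)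
      finally have "q (x + y) \<le> p ((x + s *\<^sub>R v) + (y + t *\<^sub>R v)) - (s + t) * p v" .
      with sublinear_add[OF p, of "x + s *\<^sub>R v" "y + t *\<^sub>R v"]
      show "q (x + y) - (p (y + t *\<^sub>R v) - t * p v) \<le> p (x + s *\<^sub>R v) - s * p v"
        by (simp add: algebra_simps)
    qed
    then have "q (x + y) - q x \<le> q y"
      by (intro q_ge) (simp add: algebra_simps)
    then show "q (x + y) \<le> q x + q y" by simp
  next
    have "q 0 \<le> 0"
      using q_le[of 0 0] sublinear_zero[OF p] by simp
    moreover have "0 \<le> q 0"
      using sublinear_scale[OF p] by (intro q_ge) simp
    ultimately show "q 0 = 0" by simp
  next
    fix c :: real and x assume c: "0 < c"
    have "q (c *\<^sub>R x) / c \<le> q x"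
    proof (rule q_ge)
      fix t :: real assume "0 \<le> t"
      have "q (c *\<^sub>R x) \<le> p (c *\<^sub>R x + (c * t) *\<^sub>R v) - (c * t) * p v"
        using c \<open>0 \<le> t\<close> by (intro q_le) simp
      also have "c *\<^sub>R x + (c * t) *\<^sub>R v = c *\<^sub>R (x + t *\<^sub>R v)"
        by (simp add: algebra_simps)
      also have "p \<dots> = c * p (x + t *\<^sub>R v)"
        using c by (intro sublinear_scale[OF p]) simp
      finally show "q (c *\<^sub>R x) / c \<le> p (x + t *\<^sub>R v) - t * p v"
        using c by (simp add: field_simps)
    qed
    then show "q (c *\<^sub>R x) \<le> c * q x"
      using c by (simp add: field_simps)
  qed
qed

text \<open>
  Zorn's lemma for the reversed pointwise order. The pointwise infimum of a chain is finite since
  every sublinear \<open>q \<le> p\<close> satisfies \<open>- p (- x) \<le> q x\<close>.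
\<close>

lemma minimal_sublinear_exists:
  fixes p :: "'a::real_vector \<Rightarrow> real"
  assumes p: "sublinear p"
  obtains m where "sublinear m" "m \<le> p" "\<And>q. sublinear q \<Longrightarrow> q \<le> m \<Longrightarrow> q = m"
proof -
  define \<Q> where "\<Q> = {q. sublinear q \<and> q \<le> p}"
  have "\<exists>m\<in>\<Q>. \<forall>q\<in>\<Q>. q \<le> m \<longrightarrow> q = m"
  proof (rule predicate_Zorn[where P = "\<lambda>x y. y \<le> x"])
    show "partial_order_on \<Q> (relation_of (\<lambda>x y. y \<le> x) \<Q>)"
      by (auto simp: partial_order_on_def preorder_on_def refl_on_def trans_def antisym_def
          relation_of_def)
  next
    fix C assume "C \<in> Chains (relation_of (\<lambda>x y. y \<le> x) \<Q>)"
    then have sub: "C \<subseteq> \<Q>" and tot: "\<And>q r. q \<in> C \<Longrightarrow> r \<in> C \<Longrightarrow> q \<le> r \<or> r \<le> q"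
      by (auto simp: Chains_def relation_of_def)
    show "\<exists>u\<in>\<Q>. \<forall>q\<in>C. u \<le> q"
    proof (cases "C = {}")
      case True
      then show ?thesis using p by (auto simp: \<Q>_def)
    next
      case False
      define u where "u x = (INF q\<in>C. q x)" for x
      have sl: "sublinear q" if "q \<in> C" for q
        using that sub by (auto simp: \<Q>_def)
      have lower: "- p (- x) \<le> q x" if "q \<in> C" for q x
      proof -
        have "- p (- x) \<le> - q (- x)"
          using that sub by (auto simp: \<Q>_def le_fun_def)
        also have "\<dots> \<le> q x"
          by (rule sublinear_minus_ge[OF sl[OF that]])
        finally show ?thesis .
      qed
      have u_le: "u x \<le> q x" if "q \<in> C" for q x
        unfolding u_def by (rule cINF_lower[OF bdd_belowI2 that]) (rule lower)
      have u_ge: "b \<le> u x" if "\<And>q. q \<in> C \<Longrightarrow> b \<le> q x" for b x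
        unfolding u_def by (rule cINF_greatest[OF False that])
      have "sublinear u"
      proof (rule sublinearI)
        fix x y
        have "u (x + y) - r y \<le> u x" if r: "r \<in> C" for r
        proof (rule u_ge)
          fix q assume "q \<in> C"
          \<comment> \<open>subadditivity survives the infimum because any two members of a chain are comparable\<close>
          obtain s where s: "s \<in> C" "s \<le> q" "s \<le> r"
            using tot[OF \<open>q \<in> C\<close> r] \<open>q \<in> C\<close> r by blast
          have "u (x + y) \<le> s x + s y"
            using u_le[OF s(1), of "x + y"] sublinear_add[OF sl[OF s(1)], of x y] by simp
          also have "\<dots> \<le> q x + r y"
            using s by (intro add_mono) (auto simp: le_fun_def)
          finally show "u (x + y) - r y \<le> q x" by simp
        qed
        then have "u (x + y) - u x \<le> u y"
          by (intro u_ge) (simp add: algebra_simps)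
        then show "u (x + y) \<le> u x + u y" by simp
      next
        obtain q where "q \<in> C" using False by blast
        then have "u 0 \<le> 0"
          using u_le sublinear_zero[OF sl] by metis
        moreover have "0 \<le> u 0"
          by (intro u_ge) (metis sl sublinear_zero order_refl)
        ultimately show "u 0 = 0" by simp
      next
        fix c :: real and x assume c: "0 < c"
        have "u (c *\<^sub>R x) / c \<le> u x"
        proof (rule u_ge)
          fix q assume "q \<in> C"
          with u_le[OF this, of "c *\<^sub>R x"] sublinear_scale[OF sl[OF this], of c x] c
          show "u (c *\<^sub>R x) / c \<le> q x" by (simp add: field_simps)
        qed
        then show "u (c *\<^sub>R x) \<le> c * u x"
          using c by (simp add: field_simps)
      qed
      moreover have "u \<le> p"
      proof -
        obtain q where "q \<in> C" using False by blast
        then have "u \<le> q" "q \<le> p"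
          using u_le sub by (auto simp: le_fun_def \<Q>_def)
        then show ?thesis by simp
      qed
      ultimately show ?thesis
        using u_le by (auto simp: \<Q>_def le_fun_def)
    qed
  qed
  then obtain m where m: "sublinear m" "m \<le> p"
    and "\<And>q. q \<in> \<Q> \<Longrightarrow> q \<le> m \<Longrightarrow> q = m"
    by (auto simp: \<Q>_def)
  then have "q = m" if "sublinear q" "q \<le> m" for q
    using that by (auto simp: \<Q>_def dest: order_trans)
  with m show ?thesis using that by blast
qed

lemma minimal_sublinear_linear:
  fixes m :: "'a::real_vector \<Rightarrow> real"
  assumes m: "sublinear m" and min: "\<And>q. sublinear q \<Longrightarrow> q \<le> m \<Longrightarrow> q = m"
  shows "linear m"
proof -
  have minus: "m (- v) = - m v" for v
  proof -
    obtain q where "sublinear q" "q \<le> m" "q (- v) \<le> - m v"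
      by (rule sublinear_reduce[OF m])
    with min have "m (- v) \<le> - m v" by metis
    with sublinear_minus_ge[OF m, of v] show ?thesis by simp
  qed
  show ?thesis
  proof (rule linearI)
    fix x y
    have "m x \<le> m (x + y) + m (- y)"
      using sublinear_add[OF m, of "x + y" "- y"] by simp
    with sublinear_add[OF m, of x y] show "m (x + y) = m x + m y"
      by (simp add: minus)
  next
    fix c :: real and x
    have "m (c *\<^sub>R x) = c * m x"
    proof (cases "0 \<le> c")
      case True
      then show ?thesis by (rule sublinear_scale[OF m])
    next
      case False
      then have "m ((- c) *\<^sub>R x) = (- c) * m x"
        by (intro sublinear_scale[OF m]) simp
      then show ?thesis by (simp add: minus)
    qed
    then show "m (c *\<^sub>R x) = c *\<^sub>R m x" by simp
  qed
qed

text \<open>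
  A linear minorant exists already below \<open>p\<close>; choosing it below the reduction \<open>q\<close> of \<open>p\<close> along \<open>v\<close>
  forces \<open>- f v \<le> q (- v) \<le> - p v\<close>, that is, equality at \<open>v\<close>.
\<close>

theorem Hahn_Banach_sublinear:
  fixes p :: "'a::real_vector \<Rightarrow> real"
  assumes p: "sublinear p"
  obtains f where "linear f" "f \<le> p" "f v = p v"
proof -
  obtain q where q: "sublinear q" "q \<le> p" "q (- v) \<le> - p v"
    by (rule sublinear_reduce[OF p])
  obtain f where f: "sublinear f" "f \<le> q" and "\<And>r. sublinear r \<Longrightarrow> r \<le> f \<Longrightarrow> r = f"
    by (rule minimal_sublinear_exists[OF q(1)]) blast
  then have lin: "linear f"
    by (intro minimal_sublinear_linear)
  have "- f v \<le> - p v"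
    using f(2) q(3) linear_neg[OF lin, of v] by (metis le_funD order_trans)
  moreover have "f \<le> p"
    using f(2) q(2) by (rule order_trans)
  ultimately have "f v = p v"
    by (simp add: le_fun_def antisym)
  with lin \<open>f \<le> p\<close> show ?thesis by (rule that)
qed

lemma infdist_subspace_scale_le:
  fixes S :: "'a::real_normed_vector set"
  assumes S: "subspace S" and c: "0 < c"
  shows "infdist (c *\<^sub>R x) S \<le> c * infdist x S"
proof -
  have ne: "S \<noteq> {}" using subspace_0[OF S] by blast
  have "infdist (c *\<^sub>R x) S / c \<le> infdist x S"
    unfolding infdist_notempty[OF ne, of x]
  proof (rule cINF_greatest[OF ne])
    fix s assume "s \<in> S"
    then have "infdist (c *\<^sub>R x) S \<le> dist (c *\<^sub>R x) (c *\<^sub>R s)"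
      by (intro infdist_le subspace_scale[OF S])
    also have "\<dots> = c * dist x s"
      using c by (simp add: dist_norm scaleR_diff_right[symmetric])
    finally show "infdist (c *\<^sub>R x) S / c \<le> dist x s"
      using c by (simp add: field_simps)
  qed
  then show ?thesis using c by (simp add: field_simps)
qed

lemma sublinear_infdist:
  fixes S :: "'a::real_normed_vector set"
  assumes S: "subspace S"
  shows "sublinear (\<lambda>x. infdist x S)"
proof (rule sublinearI)
  have ne: "S \<noteq> {}" using subspace_0[OF S] by blast
  fix x y
  have "infdist (x + y) S - dist y t \<le> infdist x S" if "t \<in> S" for t
    unfolding infdist_notempty[OF ne, of x]
  proof (rule cINF_greatest[OF ne])
    fix s assume "s \<in> S"
    with that have "infdist (x + y) S \<le> dist (x + y) (s + t)"
      by (intro infdist_le subspace_add[OF S])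
    also have "\<dots> \<le> dist x s + dist y t"
      by (rule dist_triangle_add)
    finally show "infdist (x + y) S - dist y t \<le> dist x s" by simp
  qed
  then have "infdist (x + y) S - infdist x S \<le> infdist y S"
    unfolding infdist_notempty[OF ne, of y]
    by (intro cINF_greatest[OF ne]) (simp add: algebra_simps)
  then show "infdist (x + y) S \<le> infdist x S + infdist y S" by simp
next
  show "infdist 0 S = 0"
    using subspace_0[OF S] by simp
qed (rule infdist_subspace_scale_le[OF S])

text \<open>
  Minorising the distance to a subspace yields in one step both consequences used below: functionals
  that separate a point from a closed subspace, and, for the zero subspace, norming functionals.
\<close>

theorem Hahn_Banach_infdist:
  fixes S :: "'a::real_normed_vector set"
  assumes S: "subspace S"
  obtains f :: "'a \<Rightarrow>\<^sub>L real"
  where "norm f \<le> 1" "\<And>s. s \<in> S \<Longrightarrow> f s = 0" "f v = infdist v S"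
proof -
  obtain g where lin: "linear g" and g: "g \<le> (\<lambda>x. infdist x S)" and gv: "g v = infdist v S"
    by (rule Hahn_Banach_sublinear[OF sublinear_infdist[OF S]])
  have le: "g x \<le> infdist x S" for x
    using g by (simp add: le_fun_def)
  have "g x \<le> norm x" for x
    using le[of x] infdist_le[OF subspace_0[OF S], of x] by simp
  from this this[of "- x" for x] have bd: "norm (g x) \<le> norm x * 1" for x
    by (simp add: linear_neg[OF lin] abs_le_iff)
  then have bl: "bounded_linear g"
    by (intro bounded_linear_intro[OF linear_add[OF lin] linear_scale[OF lin]])
  have zero: "g s = 0" if "s \<in> S" for s
    using le[of s] le[of "- s"] that subspace_neg[OF S that] by (simp add: linear_neg[OF lin])
  show ?thesis
  proof
    show "norm (Blinfun g) \<le> 1"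
      using bd by (intro norm_blinfun_bound) (auto simp: bounded_linear_Blinfun_apply[OF bl])
  qed (auto simp: bounded_linear_Blinfun_apply[OF bl] zero gv)
qed

corollary norming_functional:
  fixes v :: "'a::real_normed_vector"
  obtains f :: "'a \<Rightarrow>\<^sub>L real" where "norm f \<le> 1" "f v = norm v"
proof -
  obtain f :: "'a \<Rightarrow>\<^sub>L real" where "norm f \<le> 1" "f v = infdist v {0}"
    by (rule Hahn_Banach_infdist[OF subspace_single_0])
  then show ?thesis by (intro that) auto
qed

section \<open>The Mazur-Ulam theorem\<close>

lemma space_isometry_dist: "space_isometry T \<Longrightarrow> dist (T x) (T y) = dist x y"
  by (simp add: space_isometry_def)

lemma space_isometry_comp: "space_isometry S \<Longrightarrow> space_isometry T \<Longrightarrow> space_isometry (S \<circ> T)"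
  by (simp add: space_isometry_def bij_comp)

lemma space_isometry_inv_apply:
  assumes "space_isometry T"
  shows "T (inv T x) = x" "inv T (T x) = x"
proof -
  have "bij T" using assms by (simp add: space_isometry_def)
  show "T (inv T x) = x"
    by (rule surj_f_inv_f[OF bij_is_surj[OF \<open>bij T\<close>]])
  show "inv T (T x) = x"
    by (rule inv_f_f[OF bij_is_inj[OF \<open>bij T\<close>]])
qed

lemma space_isometry_inv:
  assumes T: "space_isometry T"
  shows "space_isometry (inv T)"
  unfolding space_isometry_def
proof (intro conjI allI)
  show "bij (inv T)"
    using T by (simp add: space_isometry_def bij_imp_bij_inv)
  show "dist (inv T x) (inv T y) = dist x y" for x y
    using space_isometry_dist[OF T, of "inv T x" "inv T y"]
    by (simp only: space_isometry_inv_apply[OF T])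
qed

lemma space_isometry_reflection:
  fixes c :: "'a::real_normed_vector"
  shows "space_isometry (\<lambda>x. c - x)"
  unfolding space_isometry_def
  by (auto intro!: involuntory_imp_bij simp: dist_norm norm_minus_commute)

text \<open>
  The Archimedean property in the form in which it replaces limits and suprema below.
\<close>

lemma nonpos_if_bounded_multiples:
  fixes d c :: real
  assumes "\<And>n::nat. real n * d \<le> c"
  shows "d \<le> 0"
proof (rule ccontr)
  assume "\<not> d \<le> 0"
  then obtain n where "c < real n * d"
    using reals_Archimedean3[of d] by auto
  with assms[of n] show False by simp
qed

text \<open>
  The argument of Vaisala. With the point reflection \<open>\<psi>\<close> at the midpoint \<open>z\<close>, the isometry
  \<open>\<psi> \<circ> inv g \<circ> \<psi> \<circ> g\<close> again fixes \<open>a\<close> and \<open>b\<close> but moves \<open>z\<close> twice as far as \<open>g\<close> does. An isometry that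
  fixes \<open>a\<close> moves \<open>z\<close> by at most twice the distance from \<open>a\<close> to \<open>z\<close>, so repeated doubling is
  impossible unless \<open>g\<close> fixes \<open>z\<close>.
\<close>

lemma isometry_fixes_midpoint:
  fixes g :: "'a::real_normed_vector \<Rightarrow> 'a"
  assumes g: "space_isometry g" "g a = a" "g b = b"
  shows "g (midpoint a b) = midpoint a b"
proof -
  define z where "z = midpoint a b"
  define \<psi> where "\<psi> x = a + b - x" for x
  have \<psi>: "space_isometry \<psi>" "\<psi> a = b" "\<psi> b = a" "\<psi> z = z"
  proof -
    show "space_isometry \<psi>"
      unfolding \<psi>_def by (rule space_isometry_reflection)
    have "a + b = z + z"
      by (simp add: z_def midpoint_def scaleR_2[symmetric])
    then show "\<psi> z = z" by (simp add: \<psi>_def)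
  qed (auto simp: \<psi>_def)
  have bound: "2 ^ n * dist (h z) z \<le> 2 * dist a z"
    if "space_isometry h" "h a = a" "h b = b" for h n
    using that
  proof (induction n arbitrary: h)
    case 0
    have "dist (h z) z \<le> dist (h z) (h a) + dist a z"
      using dist_triangle[of "h z" z a] 0 by simp
    moreover have "dist (h z) (h a) = dist z a"
      by (rule space_isometry_dist[OF 0(1)])
    ultimately show ?case
      by (simp add: dist_commute)
  next
    case (Suc n)
    define k where "k = \<psi> \<circ> inv h \<circ> \<psi> \<circ> h"
    have inv: "inv h a = a" "inv h b = b"
      using Suc.prems space_isometry_inv_apply(2) by metis+
    have "space_isometry k" "k a = a" "k b = b"
      using Suc.prems \<psi> inv
      by (auto simp: k_def intro!: space_isometry_comp space_isometry_inv)
    then have IH: "2 ^ n * dist (k z) z \<le> 2 * dist a z"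
      by (rule Suc.IH)
    have "dist (k z) z = dist (\<psi> (inv h (\<psi> (h z)))) (\<psi> z)"
      by (simp add: k_def \<psi>)
    also have "\<dots> = dist (inv h (\<psi> (h z))) (inv h (h z))"
      using \<psi>(1) Suc.prems by (simp add: space_isometry_dist space_isometry_inv_apply)
    also have "\<dots> = dist (\<psi> (h z)) (h z)"
      by (rule space_isometry_dist[OF space_isometry_inv[OF Suc.prems(1)]])
    also have "\<psi> (h z) - h z = - (2 *\<^sub>R (h z - z))"
      by (simp add: \<psi>_def z_def midpoint_def algebra_simps scaleR_2)
    then have "dist (\<psi> (h z)) (h z) = 2 * dist (h z) z"
      by (simp add: dist_norm)
    finally show ?case using IH by simp
  qed
  have "real n * dist (g z) z \<le> 2 * dist a z" for n
  proof -
    have "real n * dist (g z) z \<le> 2 ^ n * dist (g z) z"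
      by (intro mult_right_mono) (auto intro: less_imp_le of_nat_less_two_power)
    with bound[OF g, of n] show ?thesis by simp
  qed
  then have "dist (g z) z \<le> 0"
    by (rule nonpos_if_bounded_multiples)
  then show ?thesis by (simp add: z_def)
qed

text \<open>
  Following \<open>T\<close> by the reflection that swaps \<open>T a\<close> and \<open>T b\<close>, then by the inverse of \<open>T\<close> and by the
  reflection that swaps \<open>a\<close> and \<open>b\<close> gives an isometry that fixes \<open>a\<close> and \<open>b\<close>, to which the
  preceding lemma applies.
\<close>

theorem Mazur_Ulam_midpoint:
  fixes T :: "'a::real_normed_vector \<Rightarrow> 'a"
  assumes T: "space_isometry T"
  shows "T (midpoint a b) = midpoint (T a) (T b)"
proof -
  define z where "z = midpoint a b"
  have z: "a + b - z = z"
    unfolding z_def by (metis midpoint_plus_self add_diff_cancel_right')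
  define \<psi> where "\<psi> x = a + b - x" for x
  define \<psi>' where "\<psi>' x = T a + T b - x" for x
  define h where "h = \<psi> \<circ> inv T \<circ> \<psi>' \<circ> T"
  have \<psi>_iso: "space_isometry \<psi>" "space_isometry \<psi>'"
    unfolding \<psi>_def \<psi>'_def by (rule space_isometry_reflection)+
  have "space_isometry h"
    unfolding h_def using T \<psi>_iso by (intro space_isometry_comp space_isometry_inv)
  moreover have "h a = a" "h b = b"
    using T by (auto simp: h_def \<psi>_def \<psi>'_def space_isometry_inv_apply)
  ultimately have "h z = z"
    unfolding z_def by (rule isometry_fixes_midpoint)
  then have "(a + b) - inv T (\<psi>' (T z)) = (a + b) - z"
    by (simp only: z) (simp only: h_def \<psi>_def o_apply)
  then have "inv T (\<psi>' (T z)) = z"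
    by (rule diff_left_imp_eq)
  then have "T (inv T (\<psi>' (T z))) = T z"
    by (rule arg_cong)
  then have "T a + T b - T z = T z"
    by (simp only: \<psi>'_def space_isometry_inv_apply(1)[OF T])
  then have "T a + T b = 2 *\<^sub>R T z"
    by (simp only: scaleR_2 diff_eq_eq)
  then show ?thesis
    unfolding midpoint_def[of "T a"] z_def by simp
qed

text \<open>
  Homogeneity for integers is automatic. For real \<open>c\<close>, split \<open>n c\<close> into its integral and fractional
  part: \<open>n\<close> times the defect \<open>L (c x) - c L x\<close> equals the defect at the fractional part, which is
  bounded independently of \<open>n\<close>.
\<close>

lemma additive_bounded_imp_bounded_linear:
  fixes L :: "'a::real_normed_vector \<Rightarrow> 'b::real_normed_vector"
  assumes add: "\<And>x y. L (x + y) = L x + L y"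
    and bound: "\<And>x. norm (L x) \<le> norm x * K"
  shows "bounded_linear L"
proof (rule bounded_linear_intro[OF add _ bound])
  have zero: "L 0 = 0" using add[of 0 0] by simp
  have minus: "L (- x) = - L x" for x
    using add[of x "- x"] zero by (simp add: eq_neg_iff_add_eq_0 add.commute)
  have nat: "L (real n *\<^sub>R x) = real n *\<^sub>R L x" for n x
    by (induction n) (simp_all add: zero add scaleR_left_distrib)
  have int: "L (of_int k *\<^sub>R x) = of_int k *\<^sub>R L x" for k x
    by (cases k rule: int_cases2) (simp_all add: nat minus)
  fix c :: real and x
  have "real n * norm (L (c *\<^sub>R x) - c *\<^sub>R L x) \<le> norm x * K + norm x * K" for n
  proof -
    define t where "t = frac (real n * c)"
    have t: "0 \<le> t" "t \<le> 1"
      by (auto simp: t_def less_imp_le[OF frac_lt_1])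
    have nc: "real n * c = of_int \<lfloor>real n * c\<rfloor> + t"
      by (simp add: t_def frac_def)
    have "real n *\<^sub>R L (c *\<^sub>R x) = L ((of_int \<lfloor>real n * c\<rfloor> + t) *\<^sub>R x)"
      by (simp add: nat[symmetric] flip: nc)
    also have "\<dots> = of_int \<lfloor>real n * c\<rfloor> *\<^sub>R L x + L (t *\<^sub>R x)"
      by (simp add: scaleR_left_distrib add int)
    finally have "real n *\<^sub>R (L (c *\<^sub>R x) - c *\<^sub>R L x)
        = of_int \<lfloor>real n * c\<rfloor> *\<^sub>R L x + L (t *\<^sub>R x) - (of_int \<lfloor>real n * c\<rfloor> + t) *\<^sub>R L x"
      by (simp add: scaleR_diff_right flip: nc)
    then have eq: "real n *\<^sub>R (L (c *\<^sub>R x) - c *\<^sub>R L x) = L (t *\<^sub>R x) - t *\<^sub>R L x"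
      by (simp add: scaleR_left_distrib)
    have K: "0 \<le> norm x * K"
      using bound[of x] norm_ge_zero order_trans by blast
    have "norm (L (t *\<^sub>R x)) \<le> t * (norm x * K)"
      using bound[of "t *\<^sub>R x"] t by (simp add: mult_ac)
    moreover have "norm (t *\<^sub>R L x) \<le> t * (norm x * K)"
      using mult_left_mono[OF bound[of x] t(1)] t by simp
    moreover have "t * (norm x * K) \<le> norm x * K"
      using mult_right_mono[OF t(2) K] by simp
    ultimately have "norm (L (t *\<^sub>R x) - t *\<^sub>R L x) \<le> norm x * K + norm x * K"
      using norm_triangle_ineq4[of "L (t *\<^sub>R x)" "t *\<^sub>R L x"] by linarith
    then show ?thesis
      unfolding eq[symmetric] by simp
  qed
  then have "norm (L (c *\<^sub>R x) - c *\<^sub>R L x) \<le> 0"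
    by (rule nonpos_if_bounded_multiples)
  then show "L (c *\<^sub>R x) = c *\<^sub>R L x" by simp
qed

corollary Mazur_Ulam:
  fixes T :: "'a::real_normed_vector \<Rightarrow> 'a"
  assumes T: "space_isometry T"
  shows "bounded_linear (\<lambda>x. T x - T 0)"
proof (rule additive_bounded_imp_bounded_linear)
  have half: "T ((1 / 2) *\<^sub>R x) = (1 / 2) *\<^sub>R (T x + T 0)" for x
    using Mazur_Ulam_midpoint[OF T, of x 0] by (simp add: midpoint_def)
  fix x y
  define u X Y where "u = (1 / 2) *\<^sub>R T 0" and "X = (1 / 2) *\<^sub>R T (2 *\<^sub>R x)"
    and "Y = (1 / 2) *\<^sub>R T (2 *\<^sub>R y)"
  have "T (x + y) = X + Y"
    using Mazur_Ulam_midpoint[OF T, of "2 *\<^sub>R x" "2 *\<^sub>R y"]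
    by (simp add: midpoint_def scaleR_right_distrib X_def Y_def)
  moreover have "T x = X + u" "T y = Y + u"
    using half[of "2 *\<^sub>R x"] half[of "2 *\<^sub>R y"]
    by (simp_all add: scaleR_right_distrib X_def Y_def u_def)
  moreover have "T 0 = u + u"
    by (simp add: u_def flip: scaleR_left_distrib)
  ultimately show "T (x + y) - T 0 = (T x - T 0) + (T y - T 0)"
    by simp
next
  show "norm (T x - T 0) \<le> norm x * 1" for x
    using space_isometry_dist[OF T, of x 0] by (simp add: dist_norm)
qed

section \<open>The weak topology\<close>

text \<open>
  The points of the space are identified with the evaluations of all functionals at them, so that
  weak compactness can be reduced to Tychonoff's theorem in a product of copies of the reals.
\<close>

definition weak_topology :: "'a::real_normed_vector topology" where
  "weak_topology = pullback_topology UNIV (\<lambda>v (f :: 'a \<Rightarrow>\<^sub>L real). f v) euclidean"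

lemma topspace_weak_topology [simp]: "topspace weak_topology = UNIV"
  by (simp add: weak_topology_def topspace_pullback_topology)

lemma continuous_map_weak_evaluations:
  "continuous_map weak_topology euclidean (\<lambda>v (f :: 'a::real_normed_vector \<Rightarrow>\<^sub>L real). f v)"
  unfolding weak_topology_def
  using continuous_map_pullback[OF continuous_map_id] by (simp add: o_def)

lemma continuous_map_weak_functional:
  fixes f :: "'a::real_normed_vector \<Rightarrow>\<^sub>L real"
  shows "continuous_map weak_topology euclidean (\<lambda>v. f v)"
proof -
  have "continuous_map euclidean euclidean (\<lambda>\<phi> :: ('a \<Rightarrow>\<^sub>L real) \<Rightarrow> real. \<phi> f)"
    by simp
  from continuous_map_compose[OF continuous_map_weak_evaluations this]
  show ?thesis by (simp add: o_def)
qed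

lemma continuous_map_into_weak:
  assumes "\<And>f :: 'a::real_normed_vector \<Rightarrow>\<^sub>L real. continuous_map X euclideanreal (\<lambda>x. f (g x))"
  shows "continuous_map X weak_topology g"
  unfolding weak_topology_def
proof (rule continuous_map_pullback')
  show "continuous_map X euclidean ((\<lambda>v (f :: 'a \<Rightarrow>\<^sub>L real). f v) \<circ> g)"
    unfolding euclidean_product_topology[symmetric] continuous_map_componentwise_UNIV
    using assms by (simp add: o_def)
qed auto

lemma closedin_weak_functional_le:
  fixes f :: "'a::real_normed_vector \<Rightarrow>\<^sub>L real"
  shows "closedin weak_topology {v. f v \<le> c}"
  using closedin_continuous_map_preimage[OF continuous_map_weak_functional[of f], of "{..c}"]
  by simp

lemma functional_le_norm:
  fixes f :: "'a::real_normed_vector \<Rightarrow>\<^sub>L real"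
  assumes "norm f \<le> 1"
  shows "f x \<le> norm x"
proof -
  have "f x \<le> norm (f x)" by simp
  also have "\<dots> \<le> norm f * norm x" by (rule norm_blinfun)
  also have "\<dots> \<le> 1 * norm x" by (intro mult_right_mono assms norm_ge_zero)
  finally show ?thesis by simp
qed

text \<open>
  Norming functionals exhibit a ball as an intersection of weakly closed half spaces.
\<close>

lemma closedin_weak_cball:
  fixes a :: "'a::real_normed_vector"
  shows "closedin weak_topology (cball a r)"
proof -
  have "cball a r = (\<Inter>f \<in> {f :: 'a \<Rightarrow>\<^sub>L real. norm f \<le> 1}.
      {v. blinfun_apply f v \<le> blinfun_apply f a + r})"
  proof (intro set_eqI iffI)
    fix v assume "v \<in> cball a r"
    then have "f (v - a) \<le> r" if "norm f \<le> 1" for f :: "'a \<Rightarrow>\<^sub>L real"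
      using functional_le_norm[OF that, of "v - a"] by (simp add: dist_norm norm_minus_commute)
    then show "v \<in> (\<Inter>f \<in> {f :: 'a \<Rightarrow>\<^sub>L real. norm f \<le> 1}.
      {v. blinfun_apply f v \<le> blinfun_apply f a + r})"
      by (auto simp: blinfun.diff_right algebra_simps)
  next
    fix v assume v: "v \<in> (\<Inter>f \<in> {f :: 'a \<Rightarrow>\<^sub>L real. norm f \<le> 1}.
      {v. blinfun_apply f v \<le> blinfun_apply f a + r})"
    obtain f :: "'a \<Rightarrow>\<^sub>L real" where f: "norm f \<le> 1" "f (v - a) = norm (v - a)"
      by (rule norming_functional)
    with v have "f v \<le> f a + r" by blast
    with f show "v \<in> cball a r"
      by (simp add: dist_norm norm_minus_commute blinfun.diff_right)
  qed
  also have "closedin weak_topology \<dots>"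
    by (intro closedin_INT closedin_weak_functional_le) (auto intro: exI[of _ 0])
  finally show ?thesis .
qed

text \<open>
  The case of Mazur's theorem on closed convex sets that is used: it keeps the weak closure of a
  countable set norm separable.
\<close>

lemma closedin_weak_closed_subspace:
  fixes S :: "'a::real_normed_vector set"
  assumes S: "subspace S" "closed S"
  shows "closedin weak_topology S"
proof -
  have ne: "S \<noteq> {}" using subspace_0[OF S(1)] by blast
  have "S = (\<Inter>f \<in> {f :: 'a \<Rightarrow>\<^sub>L real. \<forall>s\<in>S. blinfun_apply f s = 0}.
      {v. blinfun_apply f v \<le> 0})"
  proof (intro set_eqI iffI)
    fix v assume v: "v \<in> (\<Inter>f \<in> {f :: 'a \<Rightarrow>\<^sub>L real. \<forall>s\<in>S. blinfun_apply f s = 0}.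
      {v. blinfun_apply f v \<le> 0})"
    obtain f :: "'a \<Rightarrow>\<^sub>L real" where f: "\<And>s. s \<in> S \<Longrightarrow> f s = 0" "f v = infdist v S"
      by (rule Hahn_Banach_infdist[OF S(1), where v = v]) blast
    with v have "f v \<le> 0" by blast
    with f(2) infdist_nonneg[of v S] have "infdist v S = 0" by simp
    then show "v \<in> S"
      using in_closed_iff_infdist_zero[OF S(2) ne] by simp
  qed auto
  also have "closedin weak_topology \<dots>"
    by (intro closedin_INT closedin_weak_functional_le) (auto intro: exI[of _ 0])
  finally show ?thesis .
qed

lemma inj_weak_evaluations: "inj (\<lambda>v (f :: 'a::real_normed_vector \<Rightarrow>\<^sub>L real). f v)"
proof (rule injI)
  fix x y :: 'a
  assume eq: "(\<lambda>f :: 'a \<Rightarrow>\<^sub>L real. f x) = (\<lambda>f. f y)"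
  obtain f :: "'a \<Rightarrow>\<^sub>L real" where "f (x - y) = norm (x - y)"
    by (rule norming_functional)
  with fun_cong[OF eq, of f] show "x = y"
    by (simp add: blinfun.diff_right)
qed

lemma Hausdorff_weak_topology: "Hausdorff_space (weak_topology :: 'a::real_normed_vector topology)"
proof (rule Hausdorff_space_injective_preimage[OF _ continuous_map_weak_evaluations])
  show "Hausdorff_space (euclidean :: (('a \<Rightarrow>\<^sub>L real) \<Rightarrow> real) topology)"
    unfolding euclidean_product_topology[symmetric] Hausdorff_space_product_topology by simp
  show "inj_on (\<lambda>v (f :: 'a \<Rightarrow>\<^sub>L real). f v) (topspace weak_topology)"
    using inj_weak_evaluations by simp
qed

text \<open>
  The inverse of the evaluation map is continuous into the weak topology, because each functional
  composed with it is a coordinate projection.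
\<close>

lemma compactin_weak_topologyI:
  fixes C :: "'a::real_normed_vector set"
  assumes "compact ((\<lambda>v (f :: 'a \<Rightarrow>\<^sub>L real). f v) ` C)"
  shows "compactin weak_topology C"
proof -
  define j where "j = (\<lambda>v (f :: 'a \<Rightarrow>\<^sub>L real). f v)"
  have inv_j: "inv j (j v) = v" for v
    unfolding j_def by (rule inv_f_f[OF inj_weak_evaluations])
  have "continuous_map (subtopology euclidean (j ` C)) weak_topology (inv j)"
  proof (rule continuous_map_into_weak)
    fix f :: "'a \<Rightarrow>\<^sub>L real"
    have "continuous_map (subtopology euclidean (j ` C)) euclideanreal (\<lambda>\<phi>. \<phi> f)"
      by (simp add: continuous_on_subset[OF continuous_on_product_coordinates])
    then show "continuous_map (subtopology euclidean (j ` C)) euclideanreal (\<lambda>\<phi>. f (inv j \<phi>))"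
    proof (rule continuous_map_eq)
      fix \<phi> assume "\<phi> \<in> topspace (subtopology euclidean (j ` C))"
      then obtain v where "\<phi> = j v" by auto
      then show "\<phi> f = f (inv j \<phi>)" by (simp only: inv_j) (simp add: j_def)
    qed
  qed
  moreover have "compactin (subtopology euclidean (j ` C)) (j ` C)"
    using assms by (simp add: j_def)
  ultimately have "compactin weak_topology (inv j ` j ` C)"
    by (rule image_compactin[rotated])
  then show ?thesis
    by (simp add: image_image inv_j)
qed

text \<open>
  By the Mazur-Ulam theorem a functional composed with \<open>T\<close> is again a functional up to a constant.
\<close>

lemma continuous_map_weak_isometry:
  fixes T :: "'a::real_normed_vector \<Rightarrow> 'a"
  assumes T: "space_isometry T"
  shows "continuous_map weak_topology weak_topology T"
proof (rule continuous_map_into_weak)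
  fix f :: "'a \<Rightarrow>\<^sub>L real"
  have bl: "bounded_linear (\<lambda>x. f (T x - T 0))"
    by (rule blinfun.bounded_linear_right[THEN bounded_linear_compose, OF Mazur_Ulam[OF T]])
  define g where "g = Blinfun (\<lambda>x. f (T x - T 0))"
  have "f (T x) = g x + f (T 0)" for x
    unfolding g_def bounded_linear_Blinfun_apply[OF bl] by (simp add: blinfun.diff_right)
  then have "(\<lambda>x. f (T x)) = (\<lambda>x. g x + f (T 0))"
    by (rule ext)
  then show "continuous_map weak_topology euclideanreal (\<lambda>x. f (T x))"
    by (simp only:)
      (intro continuous_map_add continuous_map_weak_functional continuous_map_const[THEN iffD2]; simp)
qed

lemma closedin_weak_fixed_points:
  fixes T :: "'a::real_normed_vector \<Rightarrow> 'a"
  assumes T: "space_isometry T"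
  shows "closedin weak_topology {v. T v = v}"
  using closedin_continuous_maps_eq[OF Hausdorff_weak_topology
      continuous_map_weak_isometry[OF T] continuous_map_id]
  by simp

section \<open>Minimal invariant sets\<close>

lemma compactin_Inter_nonempty:
  assumes "compactin X S" "\<And>C. C \<in> \<U> \<Longrightarrow> closedin X C"
    and "\<And>\<F>. finite \<F> \<Longrightarrow> \<F> \<subseteq> \<U> \<Longrightarrow> S \<inter> \<Inter>\<F> \<noteq> {}"
  shows "S \<inter> \<Inter>\<U> \<noteq> {}"
  using assms(1)[unfolded compactin_fip, THEN conjunct2, rule_format, of \<U>] assms(2,3) by simp

text \<open>
  Zorn's lemma for closed subsets of a compact set. It is used with two properties that are stable
  under intersections: convexity together with invariance, and invariance alone.
\<close>

lemma compactin_minimal_closed_subset: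
  assumes K: "compactin X K" "closedin X K" "K \<noteq> {}" "P K"
    and Inter: "\<And>\<C>. \<C> \<noteq> {} \<Longrightarrow> (\<And>S. S \<in> \<C> \<Longrightarrow> P S) \<Longrightarrow> P (\<Inter>\<C>)"
  obtains M where "closedin X M" "M \<subseteq> K" "M \<noteq> {}" "P M"
    "\<forall>N\<subseteq>M. closedin X N \<and> N \<noteq> {} \<and> P N \<longrightarrow> N = M"
proof -
  define \<A> where "\<A> = {M. closedin X M \<and> M \<subseteq> K \<and> M \<noteq> {} \<and> P M}"
  have "\<exists>M\<in>\<A>. \<forall>N\<in>\<A>. N \<subseteq> M \<longrightarrow> N = M"
  proof (rule predicate_Zorn[where P = "\<lambda>x y. y \<subseteq> x"])
    show "partial_order_on \<A> (relation_of (\<lambda>x y. y \<subseteq> x) \<A>)"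
      by (auto simp: partial_order_on_def preorder_on_def refl_on_def trans_def antisym_def
          relation_of_def)
  next
    fix \<C> assume "\<C> \<in> Chains (relation_of (\<lambda>x y. y \<subseteq> x) \<A>)"
    then have sub: "\<C> \<subseteq> \<A>" and tot: "\<And>S T. S \<in> \<C> \<Longrightarrow> T \<in> \<C> \<Longrightarrow> S \<subseteq> T \<or> T \<subseteq> S"
      by (auto simp: Chains_def relation_of_def)
    show "\<exists>M\<in>\<A>. \<forall>S\<in>\<C>. M \<subseteq> S"
    proof (cases "\<C> = {}")
      case True
      then show ?thesis using K by (auto simp: \<A>_def)
    next
      case False
      have least: "\<exists>S\<in>\<C>. \<forall>T\<in>\<F>. S \<subseteq> T" if "finite \<F>" "\<F> \<subseteq> \<C>" for \<F>
        using that
      proof (induction \<F>)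
        case empty
        then show ?case using False by blast
      next
        case (insert T \<F>)
        then obtain S where S: "S \<in> \<C>" "\<forall>T\<in>\<F>. S \<subseteq> T" by auto
        have T: "T \<in> \<C>" using insert.prems by simp
        from tot[OF S(1) T] show ?case
        proof
          assume "S \<subseteq> T"
          with S show ?thesis by (intro bexI[of _ S]) auto
        next
          assume "T \<subseteq> S"
          with S(2) T show ?thesis by (intro bexI[of _ T]) (auto dest: order_trans)
        qed
      qed
      have fip: "K \<inter> \<Inter>\<F> \<noteq> {}" if \<F>: "finite \<F>" "\<F> \<subseteq> \<C>" for \<F>
      proof -
        obtain S where S: "S \<in> \<C>" "\<forall>T\<in>\<F>. S \<subseteq> T"
          using least[OF \<F>] by blast
        then have "S \<in> \<A>" using sub by blast
        then have "S \<subseteq> K" "S \<noteq> {}" by (simp_all add: \<A>_def)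
        then obtain z where "z \<in> S" by blast
        with \<open>S \<subseteq> K\<close> S(2) have "z \<in> K \<inter> \<Inter>\<F>" by auto
        then show ?thesis by auto
      qed
      have "closedin X S" if "S \<in> \<C>" for S
        using that sub by (auto simp: \<A>_def)
      then have "K \<inter> \<Inter>\<C> \<noteq> {}"
        by (rule compactin_Inter_nonempty[OF K(1) _ fip])
      moreover have "P (\<Inter>\<C>)"
        using sub by (intro Inter False) (auto simp: \<A>_def)
      moreover have "closedin X (\<Inter>\<C>)"
        using sub False by (intro closedin_Inter) (auto simp: \<A>_def)
      moreover have "\<Inter>\<C> \<subseteq> K"
        using sub False by (auto simp: \<A>_def)
      ultimately have "\<Inter>\<C> \<in> \<A>"
        by (auto simp: \<A>_def)
      then show ?thesis by blast
    qed
  qed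
  then obtain M where M: "M \<in> \<A>" and min: "\<And>N. N \<in> \<A> \<Longrightarrow> N \<subseteq> M \<Longrightarrow> N = M"
    by blast
  show ?thesis
  proof (rule that)
    show "closedin X M" "M \<subseteq> K" "M \<noteq> {}" "P M"
      using M by (simp_all add: \<A>_def)
    show "\<forall>N\<subseteq>M. closedin X N \<and> N \<noteq> {} \<and> P N \<longrightarrow> N = M"
    proof (intro allI impI)
      fix N assume "N \<subseteq> M" "closedin X N \<and> N \<noteq> {} \<and> P N"
      with \<open>M \<subseteq> K\<close> show "N = M" by (intro min) (simp_all add: \<A>_def)
    qed
  qed
qed

text \<open>
  The set \<open>Q\<close> consists of the rational linear combinations of \<open>D\<close>: they are countably many, and
  their closure is stable under real scalars.
\<close>

lemma separable_closed_subspace: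
  fixes D :: "'a::real_normed_vector set"
  assumes "countable D"
  obtains Q where "countable Q" "subspace (closure Q)" "D \<subseteq> closure Q"
proof
  define comb :: "(rat \<times> 'a) list \<Rightarrow> 'a"
    where "comb l = (\<Sum>(r, d)\<leftarrow>l. real_of_rat r *\<^sub>R d)" for l
  define Q where "Q = comb ` lists (UNIV \<times> D)"
  show "countable Q"
    unfolding Q_def using assms by (intro countable_image countable_lists) auto
  have "d \<in> Q" if "d \<in> D" for d
    unfolding Q_def by (rule image_eqI[of _ _ "[(1, d)]"]) (use that in \<open>auto simp: comb_def\<close>)
  then show "D \<subseteq> closure Q"
    using closure_subset by blast
  have zero: "0 \<in> Q"
    unfolding Q_def by (rule image_eqI[of _ _ "[]"]) (auto simp: comb_def)
  have add: "x + y \<in> Q" if xy: "x \<in> Q" "y \<in> Q" for x y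
  proof -
    obtain k l where kl: "k \<in> lists (UNIV \<times> D)" "l \<in> lists (UNIV \<times> D)" "x = comb k" "y = comb l"
      using xy by (auto simp: Q_def)
    show ?thesis
      unfolding Q_def by (rule image_eqI[of _ _ "k @ l"]) (use kl in \<open>auto simp: comb_def\<close>)
  qed
  have scale: "real_of_rat r *\<^sub>R x \<in> Q" if x: "x \<in> Q" for r x
  proof -
    obtain l where l: "l \<in> lists (UNIV \<times> D)" "x = comb l"
      using x by (auto simp: Q_def)
    have "comb (map (\<lambda>(s, d). (r * s, d)) l) = real_of_rat r *\<^sub>R comb l"
      by (induction l) (auto simp: comb_def of_rat_mult scaleR_right_distrib)
    moreover have "map (\<lambda>(s, d). (r * s, d)) l \<in> lists (UNIV \<times> D)"
      using l(1) by auto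
    ultimately show ?thesis
      unfolding Q_def l(2) by (intro image_eqI[OF sym])
  qed
  show "subspace (closure Q)"
  proof (rule subspaceI)
    show "0 \<in> closure Q"
      using zero closure_subset by blast
  next
    fix x y assume xy: "x \<in> closure Q" "y \<in> closure Q"
    obtain f where f: "\<forall>n. f n \<in> Q" "f \<longlonglongrightarrow> x"
      using xy(1) closure_sequential[of x Q] by auto
    obtain g where g: "\<forall>n. g n \<in> Q" "g \<longlonglongrightarrow> y"
      using xy(2) closure_sequential[of y Q] by auto
    have "\<forall>n. f n + g n \<in> Q" "(\<lambda>n. f n + g n) \<longlonglongrightarrow> x + y"
      using f g by (auto intro: add tendsto_add)
    then show "x + y \<in> closure Q"
      unfolding closure_sequential by (intro exI[of _ "\<lambda>n. f n + g n"]) simp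
  next
    fix c :: real and x assume x: "x \<in> closure Q"
    \<comment> \<open>rational multiples first, then real ones by density of the rationals\<close>
    have "real_of_rat r *\<^sub>R x \<in> closure Q" for r
    proof -
      have "real_of_rat r *\<^sub>R x \<in> (\<lambda>y. real_of_rat r *\<^sub>R y) ` closure Q"
        using x by blast
      also have "\<dots> \<subseteq> closure ((\<lambda>y. real_of_rat r *\<^sub>R y) ` Q)"
        by (simp only: closure_scaleR)
      also have "\<dots> \<subseteq> closure Q"
        using scale by (intro closure_mono) auto
      finally show ?thesis .
    qed
    then have "(\<lambda>c. c *\<^sub>R x) ` \<rat> \<subseteq> closure Q"
      by (auto simp: Rats_def)
    then have "(\<lambda>c. c *\<^sub>R x) ` closure \<rat> \<subseteq> closure Q"
      by (intro image_closure_subset) (auto intro!: continuous_intros)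
    then show "c *\<^sub>R x \<in> closure Q"
      unfolding Rats_closure_real by blast
  qed
qed

text \<open>
  Invariance is an equivalence and not an inclusion, so that it passes to complements and to inverse
  maps; for a bijection it says that the set is mapped onto itself.
\<close>

definition invariant_under :: "('a \<Rightarrow> 'a) set \<Rightarrow> 'a set \<Rightarrow> bool" where
  "invariant_under G M \<longleftrightarrow> (\<forall>T\<in>G. \<forall>x. T x \<in> M \<longleftrightarrow> x \<in> M)"

lemma invariant_under_Inter:
  "(\<And>S. S \<in> \<C> \<Longrightarrow> invariant_under G S) \<Longrightarrow> invariant_under G (\<Inter>\<C>)"
  by (auto simp: invariant_under_def)

lemma invariant_under_inv:
  assumes "invariant_under G M" "T \<in> G" "space_isometry T"
  shows "inv T x \<in> M \<longleftrightarrow> x \<in> M"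
proof -
  have "T (inv T x) \<in> M \<longleftrightarrow> inv T x \<in> M"
    using assms(1,2) by (simp add: invariant_under_def)
  then show ?thesis
    by (simp only: space_isometry_inv_apply(1)[OF assms(3)])
qed

section \<open>Common fixed points of isometries on weakly compact convex sets\<close>

text \<open>
  Call a weakly open set good if its trace on \<open>M\<close> is covered by finitely many balls of radius \<open>e\<close> with
  centres in \<open>M\<close>. Preimages of good sets under the isometries and their inverses are good, so the
  points of \<open>M\<close> outside all good sets form an invariant closed set \<open>N\<close>. Separability and Baire's theorem in the compact
  Hausdorff space \<open>M\<close> give a good set that meets \<open>M\<close>, so \<open>N\<close> is not all of \<open>M\<close> and is empty by
  minimality. Hence good sets cover \<open>M\<close>, and finitely many of them suffice.
\<close>

lemma minimal_invariant_totally_bounded: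
  fixes M :: "'a::real_normed_vector set"
  assumes G: "\<And>T. T \<in> G \<Longrightarrow> space_isometry T"
    and M: "compactin weak_topology M" "M \<noteq> {}" "invariant_under G M"
    and sep: "countable Q" "M \<subseteq> closure Q"
    and min: "\<forall>N\<subseteq>M. closedin weak_topology N \<and> N \<noteq> {} \<and> invariant_under G N \<longrightarrow> N = M"
    and e: "0 < e"
  obtains F where "finite F" "F \<subseteq> M" "M \<subseteq> (\<Union>x\<in>F. cball x e)"
proof -
  have M_closed: "closedin weak_topology M"
    using M(1) by (rule compactin_imp_closedin[OF Hausdorff_weak_topology])
  define \<U> where "\<U> = {U. openin weak_topology U \<and>
      (\<exists>F. finite F \<and> F \<subseteq> M \<and> U \<inter> M \<subseteq> (\<Union>x\<in>F. cball x e))}"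
  have vimage: "S -` U \<in> \<U>" if U: "U \<in> \<U>" and S: "space_isometry S" "\<And>x. S x \<in> M \<longleftrightarrow> x \<in> M"
    for S U
  proof -
    obtain F where F: "finite F" "F \<subseteq> M" "U \<inter> M \<subseteq> (\<Union>x\<in>F. cball x e)"
      using U by (auto simp: \<U>_def)
    have "openin weak_topology (S -` U)"
      using openin_continuous_map_preimage[OF continuous_map_weak_isometry[OF S(1)], of U] U
      by (simp add: \<U>_def vimage_def)
    moreover have "inv S ` F \<subseteq> M"
    proof
      fix y assume "y \<in> inv S ` F"
      then obtain x where "x \<in> F" "y = inv S x" by blast
      then show "y \<in> M"
        using F(2) S(2)[of y] by (auto simp: space_isometry_inv_apply(1)[OF S(1)])
    qed
    moreover have "S -` U \<inter> M \<subseteq> (\<Union>x\<in>inv S ` F. cball x e)"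
    proof
      fix y assume "y \<in> S -` U \<inter> M"
      then have "S y \<in> U \<inter> M" using S(2) by blast
      with F(3) obtain x where "x \<in> F" "dist x (S y) \<le> e" by auto
      moreover have "dist (inv S x) y = dist x (S y)"
        using space_isometry_dist[OF S(1), of "inv S x" y] space_isometry_inv_apply(1)[OF S(1)]
        by metis
      ultimately have "y \<in> cball (inv S x) e" by simp
      with \<open>x \<in> F\<close> show "y \<in> (\<Union>x\<in>inv S ` F. cball x e)" by blast
    qed
    ultimately show ?thesis
      using F(1) unfolding \<U>_def by blast
  qed
  define N where "N = M - \<Union>\<U>"
  have N_closed: "closedin weak_topology N"
    unfolding N_def by (intro closedin_diff M_closed openin_Union) (auto simp: \<U>_def)
  have "invariant_under G N"
    unfolding invariant_under_def
  proof (intro ballI allI)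
    fix T x assume T: "T \<in> G"
    note iso = G[OF T]
    have inv: "T y \<in> M \<longleftrightarrow> y \<in> M" "inv T y \<in> M \<longleftrightarrow> y \<in> M" for y
      using M(3) T invariant_under_inv[OF M(3) T iso] by (auto simp: invariant_under_def)
    have "x \<in> \<Union>\<U>" if Tx: "T x \<in> \<Union>\<U>"
    proof -
      obtain U where U: "T x \<in> U" "U \<in> \<U>" using Tx by blast
      show ?thesis
        using vimage[OF U(2) iso inv(1)] U(1) by (intro UnionI[of "T -` U"]) simp_all
    qed
    moreover have "T x \<in> \<Union>\<U>" if x: "x \<in> \<Union>\<U>"
    proof -
      obtain U where U: "x \<in> U" "U \<in> \<U>" using x by blast
      show ?thesis
        using vimage[OF U(2) space_isometry_inv[OF iso] inv(2)] U(1)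
        by (intro UnionI[of "inv T -` U"]) (simp_all add: space_isometry_inv_apply(2)[OF iso])
    qed
    ultimately show "T x \<in> N \<longleftrightarrow> x \<in> N"
      using inv(1)[of x] unfolding N_def Diff_iff by metis
  qed
  moreover have "N \<noteq> M"
  proof -
    define X where "X = subtopology weak_topology M"
    define \<G> where "\<G> = (\<lambda>q. M \<inter> cball q (e / 2)) ` Q"
    have top: "topspace X = M"
      by (simp add: X_def)
    have comp: "compact_space X"
      unfolding X_def using M(1) by (rule compact_space_subtopology)
    have Haus: "Hausdorff_space X"
      unfolding X_def by (rule Hausdorff_space_subtopology[OF Hausdorff_weak_topology])
    have "M \<subseteq> \<Union>\<G>"
    proof
      fix x assume x: "x \<in> M"
      with sep(2) e obtain q where "q \<in> Q" "dist q x < e / 2"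
        using closure_approachable[of x Q] by (metis half_gt_zero subsetD)
      then have "x \<in> M \<inter> cball q (e / 2)" using x by simp
      with \<open>q \<in> Q\<close> show "x \<in> \<Union>\<G>" unfolding \<G>_def by blast
    qed
    then have "\<Union>\<G> = topspace X"
      by (auto simp: \<G>_def top)
    then have "X interior_of \<Union>\<G> \<noteq> {}"
      using M(2) interior_of_topspace[of X] by (simp add: top)
    moreover have "countable \<G>"
      unfolding \<G>_def using sep(1) by simp
    moreover have "closedin X S" if "S \<in> \<G>" for S
      using that closedin_subtopology_Int_closed[OF closedin_weak_cball]
      by (auto simp: \<G>_def X_def)
    moreover have "locally_compact_space X \<and> regular_space X"
      using comp Haus
      by (simp add: compact_imp_locally_compact_space compact_Hausdorff_imp_regular_space)
    ultimately have "\<exists>S\<in>\<G>. X interior_of S \<noteq> {}"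
      using Baire_category_alt[of X \<G>] by metis
    then obtain q where q: "q \<in> Q" "X interior_of (M \<inter> cball q (e / 2)) \<noteq> {}"
      unfolding \<G>_def by blast
    obtain U where U: "openin weak_topology U" "X interior_of (M \<inter> cball q (e / 2)) = U \<inter> M"
      using openin_interior_of[of X "M \<inter> cball q (e / 2)"]
      unfolding X_def openin_subtopology by metis
    then obtain p where p: "p \<in> U" "p \<in> M" using q(2) by blast
    have U_sub: "U \<inter> M \<subseteq> cball q (e / 2)"
      using U(2) interior_of_subset by fastforce
    \<comment> \<open>balls of radius \<open>e / 2\<close> have diameter at most \<open>e\<close>, which allows the centre to move into \<open>M\<close>\<close>
    have "U \<inter> M \<subseteq> cball p e"
    proof
      fix y assume "y \<in> U \<inter> M"
      with U_sub p have "dist q y \<le> e / 2" "dist q p \<le> e / 2" by auto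
      then show "y \<in> cball p e"
        using dist_triangle2[of p y q] by (simp add: dist_commute)
    qed
    then have "U \<in> \<U>"
      unfolding \<U>_def using U(1) p(2) by (auto intro!: exI[of _ "{p}"])
    with p show ?thesis by (auto simp: N_def)
  qed
  ultimately have "N = {}"
    using min N_closed by (metis N_def Diff_subset)
  then have "M \<subseteq> \<Union>\<U>" by (auto simp: N_def)
  moreover have "openin weak_topology U" if "U \<in> \<U>" for U
    using that by (simp add: \<U>_def)
  ultimately obtain \<V> where \<V>: "finite \<V>" "\<V> \<subseteq> \<U>" "M \<subseteq> \<Union>\<V>"
    using M(1)[unfolded compactin_def, THEN conjunct2, rule_format, of \<U>] by auto
  have "\<forall>U\<in>\<V>. \<exists>F. finite F \<and> F \<subseteq> M \<and> U \<inter> M \<subseteq> (\<Union>x\<in>F. cball x e)"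
    using \<V>(2) by (auto simp: \<U>_def)
  then obtain F where F: "\<And>U. U \<in> \<V> \<Longrightarrow> finite (F U) \<and> F U \<subseteq> M \<and> U \<inter> M \<subseteq> (\<Union>x\<in>F U. cball x e)"
    by metis
  show ?thesis
  proof (rule that)
    show "finite (\<Union>(F ` \<V>))" using \<V>(1) F by auto
    show "\<Union>(F ` \<V>) \<subseteq> M" using F by (simp add: UN_subset_iff)
    show "M \<subseteq> (\<Union>x\<in>\<Union>(F ` \<V>). cball x e)"
    proof
      fix y assume "y \<in> M"
      with \<V>(3) obtain U where "U \<in> \<V>" "y \<in> U \<inter> M" by blast
      with F[of U] obtain x where "x \<in> F U" "y \<in> cball x e" by auto
      with \<open>U \<in> \<V>\<close> show "y \<in> (\<Union>x\<in>\<Union>(F ` \<V>). cball x e)" by blast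
    qed
  qed
qed

text \<open>
  The point \<open>u\<close> is the average of \<open>F\<close>. Each \<open>m \<in> M\<close> lies within \<open>d / 2\<close> of one point of \<open>F\<close> and within
  \<open>d\<close> of the others, so its distance to the average falls short of \<open>d\<close> by at least \<open>d / 2\<close> divided by
  the number of points.
\<close>

lemma nondiametral_point:
  fixes M :: "'a::real_normed_vector set"
  assumes F: "finite F" "F \<subseteq> M" "M \<subseteq> (\<Union>x\<in>F. cball x (d / 2))"
    and M: "M \<noteq> {}" "\<And>x y. x \<in> M \<Longrightarrow> y \<in> M \<Longrightarrow> dist x y \<le> d" and d: "0 < d"
  obtains u r where "u \<in> convex hull M" "r < d" "\<And>m. m \<in> M \<Longrightarrow> dist u m \<le> r"
proof
  have "F \<noteq> {}" using F(3) M(1) by auto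
  then have n: "0 < real (card F)" using F(1) by (simp add: card_gt_0_iff)
  define w where "w = inverse (real (card F))"
  have w: "0 < w" "real (card F) * w = 1" using n by (auto simp: w_def)
  define u where "u = (\<Sum>x\<in>F. w *\<^sub>R x)"
  show "u \<in> convex hull M"
    unfolding u_def
  proof (rule convex_sum[OF F(1) convex_convex_hull])
    show "(\<Sum>x\<in>F. w) = 1" using w by simp
  qed (use w F(2) hull_subset in \<open>auto intro: less_imp_le hull_inc\<close>)
  show "d - w * (d / 2) < d" using w d by simp
  show "dist u m \<le> d - w * (d / 2)" if m: "m \<in> M" for m
  proof -
    obtain x where x: "x \<in> F" "dist x m \<le> d / 2"
      using F(3) m by auto
    have "u - m = (\<Sum>x\<in>F. w *\<^sub>R (x - m))"
      using w(2) by (simp add: u_def scaleR_diff_right sum_subtractf sum_constant_scaleR)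
    then have "dist u m \<le> (\<Sum>x\<in>F. w * dist x m)"
      using norm_sum[of "\<lambda>x. w *\<^sub>R (x - m)" F] w(1) by (simp add: dist_norm)
    also have "\<dots> = w * dist x m + (\<Sum>y\<in>F - {x}. w * dist y m)"
      by (rule sum.remove[OF F(1) x(1)])
    also have "\<dots> \<le> w * (d / 2) + (\<Sum>y\<in>F - {x}. w * d)"
      using x(2) w(1) M(2) m F(2)
      by (intro add_mono sum_mono mult_left_mono) auto
    also have "(\<Sum>y\<in>F - {x}. w * d) = (\<Sum>y\<in>F. w * d) - w * d"
      using sum.remove[OF F(1) x(1), of "\<lambda>_. w * d"] by linarith
    also have "(\<Sum>y\<in>F. w * d) = d"
      using w(2) by simp
    finally show ?thesis by (simp add: field_simps)
  qed
qed

text \<open>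
  The orbit under the group generated by a countable \<open>G\<close>, enumerated by words in the members of \<open>G\<close>
  and their inverses.
\<close>

lemma countable_orbit:
  fixes G :: "('a::metric_space \<Rightarrow> 'a) set"
  assumes G: "countable G" "\<And>T. T \<in> G \<Longrightarrow> space_isometry T"
    and C: "invariant_under G C" "x \<in> C"
  obtains D where "countable D" "D \<noteq> {}" "D \<subseteq> C" "invariant_under G D"
proof
  define H where "H = G \<union> inv ` G"
  define D where "D = (\<lambda>Ts. foldr (\<lambda>T y. T y) Ts x) ` lists H"
  show "countable D"
    unfolding D_def H_def using G(1) by (intro countable_image countable_lists) auto
  show "D \<noteq> {}" by (auto simp: D_def)
  have step: "T y \<in> D" if Ty: "T \<in> H" "y \<in> D" for T y
  proof -
    obtain Ts where "Ts \<in> lists H" "y = foldr (\<lambda>T y. T y) Ts x"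
      using Ty by (auto simp: D_def)
    with Ty show ?thesis
      unfolding D_def by (intro image_eqI[of _ _ "T # Ts"]) auto
  qed
  show "invariant_under G D"
    unfolding invariant_under_def
  proof (intro ballI allI iffI)
    fix T y assume T: "T \<in> G"
    show "T y \<in> D" if "y \<in> D" using step that T by (auto simp: H_def)
    show "y \<in> D" if "T y \<in> D"
      using step[OF _ that, of "inv T"] T space_isometry_inv_apply(2)[OF G(2)[OF T]]
      by (auto simp: H_def)
  qed
  have H_C: "T y \<in> C" if "T \<in> H" "y \<in> C" for T y
    using that C(1) invariant_under_inv[OF C(1) _ G(2)] by (auto simp: H_def invariant_under_def)
  have "foldr (\<lambda>T y. T y) Ts x \<in> C" if "Ts \<in> lists H" for Ts
    using that by (induction Ts) (auto simp: C(2) H_C)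
  then show "D \<subseteq> C" by (auto simp: D_def)
qed

lemma invariant_under_weak_closure:
  fixes D :: "'a::real_normed_vector set"
  assumes G: "\<And>T. T \<in> G \<Longrightarrow> space_isometry T" and D: "invariant_under G D"
  shows "invariant_under G (weak_topology closure_of D)"
proof -
  have image: "S y \<in> weak_topology closure_of D"
    if "space_isometry S" "\<And>z. z \<in> D \<Longrightarrow> S z \<in> D" "y \<in> weak_topology closure_of D" for S y
  proof -
    have "S y \<in> weak_topology closure_of (S ` D)"
      using continuous_map_image_closure_subset[OF continuous_map_weak_isometry[OF that(1)]] that(3)
      by blast
    also have "\<dots> \<subseteq> weak_topology closure_of D"
      using that(2) by (intro closure_of_mono) auto
    finally show ?thesis .
  qed
  show ?thesis
    unfolding invariant_under_def
  proof (intro ballI allI iffI)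
    fix T y assume T: "T \<in> G"
    show "T y \<in> weak_topology closure_of D" if "y \<in> weak_topology closure_of D"
      using image[OF G[OF T] _ that] D T by (auto simp: invariant_under_def)
    show "y \<in> weak_topology closure_of D" if "T y \<in> weak_topology closure_of D"
      using image[OF space_isometry_inv[OF G[OF T]] _ that] invariant_under_inv[OF D T G[OF T]]
        space_isometry_inv_apply(2)[OF G[OF T]]
      by simp
  qed
qed

text \<open>
  Countability of \<open>G\<close> makes the orbits, and hence the minimal set \<open>M\<close> inside an orbit closure, norm
  separable, as total boundedness requires. The minimality of \<open>C\<^sub>0\<close> among convex invariant sets then
  contradicts a positive diameter of \<open>M\<close>.
\<close>

lemma common_fixed_point_countable:
  fixes C :: "'a::real_normed_vector set"
  assumes C: "compactin weak_topology C" "convex C" "C \<noteq> {}"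
    and G: "countable G" "\<And>T. T \<in> G \<Longrightarrow> space_isometry T" "invariant_under G C"
  obtains x where "x \<in> C" "\<And>T. T \<in> G \<Longrightarrow> T x = x"
proof -
  have closedI: "closedin weak_topology S" if "compactin weak_topology S" for S :: "'a set"
    using that by (rule compactin_imp_closedin[OF Hausdorff_weak_topology])
  have C_conv: "convex C \<and> invariant_under G C"
    using C(2) G(3) by blast
  have Inter_conv: "convex (\<Inter>\<C>) \<and> invariant_under G (\<Inter>\<C>)"
    if "\<C> \<noteq> {}" "\<And>S. S \<in> \<C> \<Longrightarrow> convex S \<and> invariant_under G S" for \<C>
    using that(2) by (intro conjI convex_Inter invariant_under_Inter) simp_all
  obtain C\<^sub>0 where C\<^sub>0: "closedin weak_topology C\<^sub>0" "C\<^sub>0 \<subseteq> C" "C\<^sub>0 \<noteq> {}"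
      "convex C\<^sub>0 \<and> invariant_under G C\<^sub>0"
    and C\<^sub>0_min: "\<forall>N\<subseteq>C\<^sub>0. closedin weak_topology N \<and> N \<noteq> {} \<and>
      (convex N \<and> invariant_under G N) \<longrightarrow> N = C\<^sub>0"
    by (rule compactin_minimal_closed_subset[where P = "\<lambda>S. convex S \<and> invariant_under G S",
          OF C(1) closedI[OF C(1)] C(3) C_conv Inter_conv])
  obtain x where "x \<in> C\<^sub>0" using C\<^sub>0(3) by blast
  obtain D where D: "countable D" "D \<noteq> {}" "D \<subseteq> C\<^sub>0" "invariant_under G D"
    by (rule countable_orbit[OF G(1,2) C\<^sub>0(4)[THEN conjunct2] \<open>x \<in> C\<^sub>0\<close>])
  obtain Q where Q: "countable Q" "subspace (closure Q)" "D \<subseteq> closure Q"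
    by (rule separable_closed_subspace[OF D(1)])
  define K where "K = weak_topology closure_of D"
  have K_sub: "K \<subseteq> C\<^sub>0" "K \<subseteq> closure Q"
    unfolding K_def
    by (rule closure_of_minimal[OF D(3) C\<^sub>0(1)],
        rule closure_of_minimal[OF Q(3) closedin_weak_closed_subspace[OF Q(2) closed_closure]])
  have K: "closedin weak_topology K" "K \<noteq> {}" "invariant_under G K"
  proof -
    show "closedin weak_topology K" by (simp add: K_def)
    show "K \<noteq> {}" using D(2) closure_of_subset[of D weak_topology] by (auto simp: K_def)
    show "invariant_under G K"
      unfolding K_def by (rule invariant_under_weak_closure[OF G(2) D(4)])
  qed
  have K_comp: "compactin weak_topology K"
    using C(1) K_sub(1) C\<^sub>0(2) K(1) by (meson closed_compactin order_trans)
  obtain M where M: "closedin weak_topology M" "M \<subseteq> K" "M \<noteq> {}" "invariant_under G M"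
    and M_min: "\<forall>N\<subseteq>M. closedin weak_topology N \<and> N \<noteq> {} \<and> invariant_under G N \<longrightarrow> N = M"
    by (rule compactin_minimal_closed_subset[where P = "invariant_under G",
          OF K_comp K invariant_under_Inter])
  have M_comp: "compactin weak_topology M"
    by (rule closed_compactin[OF K_comp M(2,1)])
  have M_sub: "M \<subseteq> C\<^sub>0" "M \<subseteq> closure Q"
    using M(2) K_sub by auto
  have tot_bd: "\<exists>F. finite F \<and> F \<subseteq> M \<and> M \<subseteq> (\<Union>x\<in>F. cball x e)" if "0 < e" for e
    using minimal_invariant_totally_bounded[OF G(2) M_comp M(3,4) Q(1) M_sub(2) M_min that]
    by metis
  obtain F where "finite F" "M \<subseteq> (\<Union>x\<in>F. cball x 1)"
    using tot_bd[of 1] by auto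
  then have bd: "bounded M"
    by (meson bounded_UN bounded_cball bounded_subset)
  define d where "d = diameter M"
  have le_d: "dist x y \<le> d" if "x \<in> M" "y \<in> M" for x y
    unfolding d_def using diameter_bounded_bound[OF bd that] .
  have "d = 0"
  proof (rule ccontr)
    assume "d \<noteq> 0"
    then have d: "0 < d"
      using diameter_ge_0[OF bd] by (simp add: d_def)
    obtain F where F: "finite F" "F \<subseteq> M" "M \<subseteq> (\<Union>x\<in>F. cball x (d / 2))"
      using tot_bd[of "d / 2"] d by auto
    obtain u r where u: "u \<in> convex hull M" "r < d" "\<And>m. m \<in> M \<Longrightarrow> dist u m \<le> r"
      using nondiametral_point[OF F M(3) le_d d] by blast
    \<comment> \<open>minimality of \<open>C\<^sub>0\<close> makes every point of \<open>C\<^sub>0\<close>, in particular of \<open>M\<close>, as central as \<open>u\<close>\<close>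
    define N where "N = C\<^sub>0 \<inter> (\<Inter>m\<in>M. cball m r)"
    have "u \<in> C\<^sub>0"
      using u(1) hull_minimal[of M C\<^sub>0 convex] M_sub(1) C\<^sub>0(4) by blast
    then have "N \<noteq> {}"
      using u(3) by (auto simp: N_def dist_commute)
    moreover have "closedin weak_topology N"
      unfolding N_def by (intro closedin_Int C\<^sub>0(1) closedin_INT closedin_weak_cball M(3))
    moreover have "convex N"
      unfolding N_def using C\<^sub>0(4) by (intro convex_Int convex_INT) auto
    moreover have "invariant_under G N"
      unfolding invariant_under_def
    proof (intro ballI allI)
      fix T z assume T: "T \<in> G"
      have TM: "T m \<in> M \<longleftrightarrow> m \<in> M" "T m \<in> C\<^sub>0 \<longleftrightarrow> m \<in> C\<^sub>0" for m
        using M(4) C\<^sub>0(4) T by (auto simp: invariant_under_def)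
      have "(\<forall>m\<in>M. dist m (T z) \<le> r) \<longleftrightarrow> (\<forall>m\<in>M. dist (T m) (T z) \<le> r)"
      proof (intro iffI ballI)
        fix m assume "\<forall>m\<in>M. dist (T m) (T z) \<le> r" "m \<in> M"
        then have "dist (T (inv T m)) (T z) \<le> r"
          using invariant_under_inv[OF M(4) T G(2)[OF T]] by blast
        then show "dist m (T z) \<le> r"
          by (simp only: space_isometry_inv_apply(1)[OF G(2)[OF T]])
      qed (simp add: TM)
      also have "\<dots> \<longleftrightarrow> (\<forall>m\<in>M. dist m z \<le> r)"
        by (simp add: space_isometry_dist[OF G(2)[OF T]])
      finally show "T z \<in> N \<longleftrightarrow> z \<in> N"
        by (auto simp: N_def TM)
    qed
    moreover have "N \<subseteq> C\<^sub>0" by (simp add: N_def)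
    ultimately have "N = C\<^sub>0"
      using C\<^sub>0_min by simp
    have "dist x y \<le> r" if xy: "x \<in> M" "y \<in> M" for x y
    proof -
      have "y \<in> N" using xy(2) M_sub(1) \<open>N = C\<^sub>0\<close> by blast
      with xy(1) have "y \<in> cball x r" unfolding N_def by blast
      then show ?thesis by simp
    qed
    then have "d \<le> r"
      unfolding d_def using M(3) by (intro diameter_le) (auto simp: dist_norm)
    with u(2) show False by simp
  qed
  obtain m where m: "m \<in> M" using M(3) by blast
  show ?thesis
  proof (rule that[of m])
    show "m \<in> C" using m M_sub(1) C\<^sub>0(2) by blast
    show "T m = m" if "T \<in> G" for T
    proof -
      have "T m \<in> M" using M(4) m that by (auto simp: invariant_under_def)
      with le_d[OF this m] \<open>d = 0\<close> show ?thesis by simp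
    qed
  qed
qed

text \<open>
  Finitely many isometries have a common fixed point by the countable case; the fixed point sets are
  weakly closed, so the general case follows from the finite intersection property.
\<close>

theorem common_fixed_point_weakly_compact:
  fixes C :: "'a::real_normed_vector set"
  assumes C: "compactin weak_topology C" "convex C" "C \<noteq> {}"
    and G: "\<And>T. T \<in> G \<Longrightarrow> space_isometry T" "invariant_under G C"
  obtains x where "x \<in> C" "\<And>T. T \<in> G \<Longrightarrow> T x = x"
proof -
  define Fix where "Fix = (\<lambda>T. {v :: 'a. T v = v}) ` G"
  have fip: "C \<inter> \<Inter>\<F> \<noteq> {}" if \<F>: "finite \<F>" "\<F> \<subseteq> Fix" for \<F>
  proof -
    obtain H where H: "H \<subseteq> G" "finite H" "\<F> = (\<lambda>T. {v. T v = v}) ` H"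
      using finite_subset_image[OF \<F>(1)] \<F>(2) unfolding Fix_def by blast
    have "invariant_under H C"
      using G(2) H(1) by (auto simp: invariant_under_def)
    moreover have "space_isometry T" if "T \<in> H" for T
      using that H(1) G(1) by blast
    ultimately obtain x where x: "x \<in> C" "\<forall>T\<in>H. T x = x"
      using common_fixed_point_countable[OF C countable_finite[OF H(2)]] by metis
    then have "x \<in> C \<inter> \<Inter>\<F>" by (simp add: H(3))
    then show ?thesis by (rule ex_in_conv[THEN iffD1, OF exI])
  qed
  have "closedin weak_topology S" if "S \<in> Fix" for S
    using that G(1) closedin_weak_fixed_points by (auto simp: Fix_def)
  then have "C \<inter> \<Inter>Fix \<noteq> {}"
    by (rule compactin_Inter_nonempty[OF C(1) _ fip])
  then obtain x where x: "x \<in> C" "x \<in> \<Inter>Fix" by blast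
  show ?thesis
  proof (rule that[OF x(1)])
    show "T x = x" if "T \<in> G" for T
      using x(2) that by (simp add: Fix_def)
  qed
qed

section \<open>Chebyshev centres in L-embedded spaces\<close>

lemma bidual_embedding_apply: "bidual_embedding v f = f v"
  by (simp add: bidual_embedding.rep_eq)

lemma bidual_embedding_diff: "bidual_embedding (v - w) = bidual_embedding v - bidual_embedding w"
  by (rule blinfun_eqI) (simp add: bidual_embedding_apply blinfun.diff_left blinfun.diff_right)

lemma norm_bidual_embedding:
  fixes v :: "'a::real_normed_vector"
  shows "norm (bidual_embedding v) = norm v"
proof (rule antisym)
  show "norm (bidual_embedding v) \<le> norm v"
  proof (rule norm_blinfun_bound)
    show "norm (bidual_embedding v f) \<le> norm v * norm f" for f
      unfolding bidual_embedding_apply using norm_blinfun[of f v] by (simp add: mult.commute)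
  qed simp
  obtain f :: "'a \<Rightarrow>\<^sub>L real" where f: "norm f \<le> 1" "f v = norm v"
    by (rule norming_functional)
  have "norm v = norm (bidual_embedding v f)"
    by (simp add: bidual_embedding_apply f)
  also have "\<dots> \<le> norm (bidual_embedding v) * norm f"
    by (rule norm_blinfun)
  also have "\<dots> \<le> norm (bidual_embedding v) * 1"
    by (intro mult_left_mono f norm_ge_zero)
  finally show "norm v \<le> norm (bidual_embedding v)" by simp
qed

text \<open>
  The intersection of the balls of radius \<open>s\<close> about the points of \<open>A\<close> in the bidual, as a set of plain
  functions on the dual: in this form it carries the product topology, that is, the weak-* topology.
  Boundedness of \<open>\<phi>\<close> is a consequence of the last condition when \<open>A\<close> is non-empty.
\<close>

definition bidual_near :: "'a::real_normed_vector set \<Rightarrow> real \<Rightarrow> (('a \<Rightarrow>\<^sub>L real) \<Rightarrow> real) set" where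
  "bidual_near A s = {\<phi>. (\<forall>f g. \<phi> (f + g) = \<phi> f + \<phi> g) \<and> (\<forall>c f. \<phi> (c *\<^sub>R f) = c * \<phi> f) \<and>
     (\<forall>f. \<forall>a\<in>A. \<bar>\<phi> f - blinfun_apply f a\<bar> \<le> s * norm f)}"

lemma closed_bidual_near:
  fixes A :: "'a::real_normed_vector set"
  shows "closed (bidual_near A s)"
proof -
  have cont: "continuous_on UNIV (\<lambda>\<phi> :: ('a \<Rightarrow>\<^sub>L real) \<Rightarrow> real. \<phi> f)" for f
    by (rule continuous_on_product_coordinates)
  show ?thesis
    unfolding bidual_near_def Ball_def
    by (intro closed_Collect_conj closed_Collect_all closed_Collect_imp closed_Collect_eq
        closed_Collect_le continuous_intros cont) simp
qed

text \<open>
  The Banach-Alaoglu argument: the values at each functional range over a compact interval.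
\<close>

lemma compact_bidual_near:
  fixes A :: "'a::real_normed_vector set"
  assumes "A \<noteq> {}"
  shows "compact (bidual_near A s)"
proof -
  obtain a where a: "a \<in> A" using assms by blast
  define B where "B = PiE UNIV (\<lambda>f :: 'a \<Rightarrow>\<^sub>L real.
      {blinfun_apply f a - s * norm f .. blinfun_apply f a + s * norm f})"
  have "compactin (product_topology (\<lambda>_. euclideanreal) UNIV) B"
    unfolding B_def compactin_PiE by simp
  then have "compact B"
    by (simp add: euclidean_product_topology)
  moreover have "bidual_near A s \<subseteq> B"
    using a by (auto simp: bidual_near_def B_def abs_le_iff algebra_simps)
  ultimately show ?thesis
    using closed_bidual_near[of A s] by (metis closed_Int_compact inf.absorb1)
qed

lemma bidual_nearE:
  fixes A :: "'a::real_normed_vector set"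
  assumes \<phi>: "\<phi> \<in> bidual_near A s" and A: "A \<noteq> {}" and s: "0 \<le> s"
  obtains z where "blinfun_apply z = \<phi>" "\<And>a. a \<in> A \<Longrightarrow> norm (z - bidual_embedding a) \<le> s"
proof -
  have near: "\<bar>\<phi> f - f a\<bar> \<le> s * norm f" if "a \<in> A" for f a
    using \<phi> that by (simp add: bidual_near_def)
  obtain a where a: "a \<in> A" using A by blast
  have "bounded_linear \<phi>"
  proof (rule bounded_linear_intro)
    show "norm (\<phi> f) \<le> norm f * (norm a + s)" for f
      using near[OF a, of f] norm_blinfun[of f a] by (simp add: algebra_simps)
  qed (use \<phi> in \<open>auto simp: bidual_near_def\<close>)
  then have z: "blinfun_apply (Blinfun \<phi>) = \<phi>"
    by (rule bounded_linear_Blinfun_apply)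
  show ?thesis
  proof (rule that[OF z])
    show "norm (Blinfun \<phi> - bidual_embedding a) \<le> s" if "a \<in> A" for a
      by (rule norm_blinfun_bound[OF s])
        (use near[OF that] in \<open>simp add: blinfun.diff_left z bidual_embedding_apply\<close>)
  qed
qed

text \<open>
  Compactness in the bidual makes the set of centres there non-empty, and the norm decomposition
  shows that a centre with a non-zero component in \<open>V\<^sub>0\<close> could be improved by dropping it. The set of
  centres is therefore the same in the space and in its bidual.
\<close>

lemma L_embedded_Chebyshev_center:
  fixes A :: "'a::real_normed_vector set"
  assumes L: "L_embedded TYPE('a)" and A: "A \<noteq> {}" "bounded A"
  obtains r where "compactin weak_topology (\<Inter>a\<in>A. cball a r)" "(\<Inter>a\<in>A. cball a r) \<noteq> {}"
    "\<And>v. r \<le> (SUP a\<in>A. norm (v - a))"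
proof
  define rad where "rad v = (SUP a\<in>A. norm (v - a))" for v
  define r where "r = (INF v. rad v)"
  define j where "j = (\<lambda>v (f :: 'a \<Rightarrow>\<^sub>L real). f v)"
  have norm_le_rad: "norm (v - a) \<le> rad v" if "a \<in> A" for v a
  proof -
    obtain b where b: "\<And>x. x \<in> A \<Longrightarrow> norm x \<le> b"
      using A(2) by (auto simp: bounded_iff)
    have "bdd_above ((\<lambda>a. norm (v - a)) ` A)"
    proof (rule bdd_aboveI2)
      show "norm (v - x) \<le> norm v + b" if "x \<in> A" for x
        using norm_triangle_ineq4[of v x] b[OF that] by simp
    qed
    then show ?thesis
      unfolding rad_def using that by (rule cSUP_upper[rotated])
  qed
  have rad_le: "rad v \<le> s" if "\<And>a. a \<in> A \<Longrightarrow> norm (v - a) \<le> s" for v s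
    unfolding rad_def using A(1) that by (rule cSUP_least)
  have rad_nonneg: "0 \<le> rad v" for v
    using A(1) norm_le_rad norm_ge_zero order_trans by (metis ex_in_conv)
  have r_le: "r \<le> rad v" for v
    unfolding r_def by (rule cINF_lower) (auto intro: bdd_belowI2 rad_nonneg)
  then show "r \<le> (SUP a\<in>A. norm (v - a))" for v
    by (simp add: rad_def)
  have r_nonneg: "0 \<le> r"
    unfolding r_def by (rule cINF_greatest) (auto intro: rad_nonneg)
  have j_near: "j v \<in> bidual_near A s" if v: "\<And>a. a \<in> A \<Longrightarrow> norm (v - a) \<le> s" for v s
  proof -
    have "\<bar>f v - f a\<bar> \<le> s * norm f" if "a \<in> A" for f :: "'a \<Rightarrow>\<^sub>L real" and a
    proof -
      have "\<bar>f v - f a\<bar> \<le> norm f * norm (v - a)"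
        using norm_blinfun[of f "v - a"] by (simp add: blinfun.diff_right)
      also have "\<dots> \<le> norm f * s"
        by (intro mult_left_mono v that norm_ge_zero)
      finally show ?thesis by (simp add: mult.commute)
    qed
    then show ?thesis
      by (simp add: bidual_near_def j_def blinfun.add_left blinfun.scaleR_left)
  qed
  have "bidual_near A r \<noteq> {}"
  proof -
    define \<U> where "\<U> = bidual_near A ` {r<..}"
    have fip: "bidual_near A (r + 1) \<inter> \<Inter>\<F> \<noteq> {}" if \<F>: "finite \<F>" "\<F> \<subseteq> \<U>" for \<F>
    proof -
      obtain S where S: "S \<subseteq> {r<..}" "finite S" "\<F> = bidual_near A ` S"
        using finite_subset_image[OF \<F>(1)] \<F>(2) unfolding \<U>_def by blast
      define s where "s = Min (insert (r + 1) S)"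
      have "r < s" using S(1,2) by (auto simp: s_def)
      have "bdd_below (range rad)"
        by (rule bdd_belowI2) (rule rad_nonneg)
      with \<open>r < s\<close> obtain v where v: "rad v < s"
        unfolding r_def using cINF_less_iff[of UNIV rad s] by auto
      have "j v \<in> bidual_near A t" if "t \<in> insert (r + 1) S" for t
      proof (rule j_near)
        fix a assume "a \<in> A"
        have "s \<le> t" unfolding s_def using S(2) that by (intro Min_le) auto
        with v norm_le_rad[OF \<open>a \<in> A\<close>, of v] show "norm (v - a) \<le> t" by simp
      qed
      then show ?thesis by (auto simp: S(3))
    qed
    have "closedin euclidean S" if "S \<in> \<U>" for S
      using that closed_bidual_near[of A] by (auto simp: \<U>_def)
    moreover have "compactin euclidean (bidual_near A (r + 1))"
      using compact_bidual_near[OF A(1)] by simp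
    ultimately have "bidual_near A (r + 1) \<inter> \<Inter>\<U> \<noteq> {}"
      using compactin_Inter_nonempty[OF _ _ fip] by blast
    then obtain \<phi> where \<phi>: "\<And>s. r < s \<Longrightarrow> \<phi> \<in> bidual_near A s"
      by (auto simp: \<U>_def)
    have "\<bar>\<phi> f - f a\<bar> \<le> r * norm f" if "a \<in> A" for f a
    proof -
      have le: "\<bar>\<phi> f - f a\<bar> \<le> s * norm f" if "r < s" for s
        using \<phi>[OF that] \<open>a \<in> A\<close> by (simp add: bidual_near_def)
      show ?thesis
      proof (cases "norm f = 0")
        case True
        then show ?thesis using le[of "r + 1"] by simp
      next
        case False
        then have "\<bar>\<phi> f - f a\<bar> / norm f \<le> s" if "r < s" for s
          using le[OF that] by (simp add: divide_le_eq)
        then have "\<bar>\<phi> f - f a\<bar> / norm f \<le> r" by (rule dense_ge)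
        with False show ?thesis by (simp add: divide_le_eq)
      qed
    qed
    then have "\<phi> \<in> bidual_near A r"
      using \<phi>[of "r + 1"] by (simp add: bidual_near_def)
    then show ?thesis by blast
  qed
  moreover have image: "bidual_near A r = j ` (\<Inter>a\<in>A. cball a r)"
  proof (intro equalityI subsetI)
    fix \<phi> assume "\<phi> \<in> j ` (\<Inter>a\<in>A. cball a r)"
    then show "\<phi> \<in> bidual_near A r"
      by (auto simp: dist_norm norm_minus_commute intro!: j_near)
  next
    fix \<phi> assume \<phi>: "\<phi> \<in> bidual_near A r"
    obtain z where z: "blinfun_apply z = \<phi>" "\<And>a. a \<in> A \<Longrightarrow> norm (z - bidual_embedding a) \<le> r"
      by (rule bidual_nearE[OF \<phi> A(1) r_nonneg]) blast
    \<comment> \<open>a component \<open>w\<close> in \<open>V\<^sub>0\<close> would leave \<open>v\<close> with a radius below the infimum \<open>r\<close>\<close>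
    obtain V\<^sub>0 where V\<^sub>0: "l1_direct_sum (range (bidual_embedding :: 'a \<Rightarrow> _)) V\<^sub>0"
      using L by (auto simp: L_embedded_def)
    then obtain v w where w: "w \<in> V\<^sub>0" "z = bidual_embedding v + w"
      unfolding l1_direct_sum_def by blast
    have split: "norm (v - a) + norm w \<le> r" if "a \<in> A" for a
    proof -
      have "z - bidual_embedding a = bidual_embedding (v - a) + w"
        by (simp add: w(2) bidual_embedding_diff)
      moreover have "norm (bidual_embedding (v - a) + w) = norm (bidual_embedding (v - a)) + norm w"
        using V\<^sub>0 w(1) by (simp add: l1_direct_sum_def)
      ultimately show ?thesis
        using z(2)[OF that] by (simp add: norm_bidual_embedding)
    qed
    have "rad v \<le> r - norm w"
      by (rule rad_le) (use split in \<open>simp add: algebra_simps\<close>)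
    with r_le[of v] have "norm w \<le> 0" by linarith
    then have "w = 0" by simp
    with w(2) z(1) have "\<phi> = j v"
      by (auto simp: j_def bidual_embedding_apply)
    moreover have "v \<in> (\<Inter>a\<in>A. cball a r)"
      using split \<open>w = 0\<close> by (simp add: dist_norm norm_minus_commute)
    ultimately show "\<phi> \<in> j ` (\<Inter>a\<in>A. cball a r)" by blast
  qed
  ultimately show "(\<Inter>a\<in>A. cball a r) \<noteq> {}" by auto
  show "compactin weak_topology (\<Inter>a\<in>A. cball a r)"
    using compact_bidual_near[OF A(1), of r] image
    by (intro compactin_weak_topologyI) (simp add: j_def)
qed

section \<open>Isometries preserving a bounded set\<close>

theorem theorem1:
  fixes A :: "'a::banach set"
  assumes "L_embedded TYPE('a)"
    and "A \<noteq> {}"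
    and "bounded A"
  shows "\<exists>v\<^sub>0::'a.
           (\<forall>T. space_isometry T \<and> T ` A = A \<longrightarrow> T v\<^sub>0 = v\<^sub>0) \<and>
           (\<forall>v. (SUP a\<in>A. norm (v\<^sub>0 - a)) \<le> (SUP a\<in>A. norm (v - a)))"
proof -
  obtain r where C: "compactin weak_topology (\<Inter>a\<in>A. cball a r)" "(\<Inter>a\<in>A. cball a r) \<noteq> {}"
    and r: "\<And>v. r \<le> (SUP a\<in>A. norm (v - a))"
    using L_embedded_Chebyshev_center[OF assms] by blast
  define G where "G = {T :: 'a \<Rightarrow> 'a. space_isometry T \<and> T ` A = A}"
  have conv: "convex (\<Inter>a\<in>A. cball a r)"
    by (intro convex_INT convex_cball)
  have inv: "invariant_under G (\<Inter>a\<in>A. cball a r)"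
    unfolding invariant_under_def
  proof (intro ballI allI)
    fix T v assume "T \<in> G"
    then have T: "space_isometry T" "T ` A = A" by (auto simp: G_def)
    have "T v \<in> (\<Inter>a\<in>T ` A. cball a r) \<longleftrightarrow> v \<in> (\<Inter>a\<in>A. cball a r)"
      by (simp add: space_isometry_dist[OF T(1)])
    then show "T v \<in> (\<Inter>a\<in>A. cball a r) \<longleftrightarrow> v \<in> (\<Inter>a\<in>A. cball a r)"
      by (simp only: T(2))
  qed
  have iso: "space_isometry T" if "T \<in> G" for T
    using that by (simp add: G_def)
  obtain v\<^sub>0 where v\<^sub>0: "v\<^sub>0 \<in> (\<Inter>a\<in>A. cball a r)" "\<And>T. T \<in> G \<Longrightarrow> T v\<^sub>0 = v\<^sub>0"
    using common_fixed_point_weakly_compact[OF C(1) conv C(2) iso inv] by blast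
  have "(SUP a\<in>A. norm (v\<^sub>0 - a)) \<le> r"
    using v\<^sub>0(1) by (intro cSUP_least[OF assms(2)]) (simp add: dist_norm norm_minus_commute)
  with r have "(SUP a\<in>A. norm (v\<^sub>0 - a)) \<le> (SUP a\<in>A. norm (v - a))" for v
    by (rule order_trans[rotated])
  with v\<^sub>0(2) show ?thesis
    by (auto simp: G_def)
qed

end
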